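(* Let $F\in\mathcal F$, set $L_n(f)=\widehat f(n)$ for $f\in F$, $n\in\mathbb Z$, let $M\neq\{0\}$ be a closed subspace of $F^+:=F\cap\mathcal H(\mathbb D)$ having the division property at $0$, let $\pi:F^+\to F^+/M$ be the canonical surjection, and let $U_0:F^+/M\to F^+/M$ be the linear map satisfying $U_0\circ\pi\circ S_{|F^+}=\pi$. If $\sum_{p=1}^{+\infty}\Vert L_{-p}\Vert\,\Vert U_0^p\pi(1)\Vert<+\infty$, then $$\left[\mathrm{span}\left(\bigcup_{p\ge0}\mathbf S_{|F}^{-p}(M)\right)\right]^-\cap F^+=M$$ and $$\left[\mathrm{span}\left(\bigcup_{p\ge0}\mathbf S_{|F}^{-p}(F^+)\right)\right]^-=\left[\mathrm{span}\left(\bigcup_{p\ge0}\mathbf S_{|F}^{-p}(M)\right)\right]^-+F^+.$$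
   Context: $\mathbb D$ is the open unit disc, $\mathbb T$ the unit circle, $\mathcal H(\mathbb D)$ the space of holomorphic functions on $\mathbb D$; $Sf(z)=zf(z)$ on $\mathcal H(\mathbb D)$. A linear subspace $M$ of $\mathcal H(\mathbb D)$ has the division property at $\lambda\in\mathbb D$ if for every $f\in M$ with $f(\lambda)=0$ the function $z\mapsto\frac{f(z)}{z-\lambda}$ belongs to $M$. $\mathcal H_0(\mathbb C\setminus\overline{\mathbb D})$ is the space of holomorphic functions on $\mathbb C\setminus\overline{\mathbb D}$ vanishing at infinity. Hyperfunctions on $\mathbb T$: $\mathcal{HF}(\mathbb T)$ is the set of pairs $f=(f^+,f^-)$ with $f^+\in\mathcal H(\mathbb D)$, $f^-\in\mathcal H_0(\mathbb C\setminus\overline{\mathbb D})$; Fourier coefficients are defined by $f^+(\zeta)=\sum_{n\ge0}\widehat f(n)\zeta^n$ ($|\zeta|<1$), $f^-(\zeta)=\sum_{n<0}\widehat f(n)\zeta^n$ ($|\zeta|>1$). $\mathcal H(\mathbb D)$ is identified with a subspace of $\mathcal{HF}(\mathbb T)$ via $g\mapsto(g,0)$. The bilateral shift $\mathbf S$ is the bijection of $\mathcal{HF}(\mathbb T)$ given by $\widehat{\mathbf Sf}(n)=\widehat f(n-1)$. $P^+:(f^+,f^-)\mapsto f^+=(f^+,0)$. $\mathcal F$ is the class of nonzero Banach spaces $F\subset\mathcal{HF}(\mathbb T)$ such that $P^+(F)\subset F$ with $P^+_{|F}:F\to F$ continuous, and $\mathbf S(F)\subset F$ with $\mathbf S_{|F}:F\to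 F$ continuous and $\mathrm{Spec}(\mathbf S_{|F})\subset\mathbb T$. For $F\in\mathcal F$, the functionals $L_n$ are continuous on $F$, $F^+$ is closed in $F$, stable under $S$, and contains the constant function $1$; the map $U_0$ exists and is unique when $M\ne\{0\}$ is a linear subspace of $F^+$ with the division property at $0$. $\Vert L_{-p}\Vert$ is the norm in the dual of $F$, $\Vert U_0^p\pi(1)\Vert$ is the quotient norm on $F^+/M$, and $[\cdot]^-$ denotes closure in $F$. *)

theory Defs
  imports "HOL-Complex_Analysis.Complex_Analysis" "HOL-Library.Set_Algebras"
begin

text \<open>
  A function on the disc, or on the exterior of the closed disc, is represented by a total
  function that is \<open>0\<close> outside the domain, so that equality of hyperfunctions is equality of
  pairs of functions on their domains.
\<close>

typedef hyperfunction =
  "{(f, g).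
      f holomorphic_on ball 0 1 \<and> (\<forall>z. z \<notin> ball 0 1 \<longrightarrow> f z = 0) \<and>
      g holomorphic_on (- cball 0 1) \<and> (\<forall>z\<in>cball 0 1. g z = 0) \<and> (g \<longlongrightarrow> 0) at_infinity}"
  by (rule exI[of _ "(\<lambda>_. 0, \<lambda>_. 0)"]) auto

setup_lifting type_definition_hyperfunction

lift_definition hplus :: "hyperfunction \<Rightarrow> complex \<Rightarrow> complex" is fst .

lift_definition hminus :: "hyperfunction \<Rightarrow> complex \<Rightarrow> complex" is snd .

instantiation hyperfunction :: ab_group_add
begin

lift_definition zero_hyperfunction :: hyperfunction is "(\<lambda>_. 0, \<lambda>_. 0)"
  by auto

lift_definition plus_hyperfunction :: "hyperfunction \<Rightarrow> hyperfunction \<Rightarrow> hyperfunction"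
  is "\<lambda>f g. (\<lambda>z. fst f z + fst g z, \<lambda>z. snd f z + snd g z)"
  by (auto intro!: holomorphic_intros tendsto_add_zero)

lift_definition uminus_hyperfunction :: "hyperfunction \<Rightarrow> hyperfunction"
  is "\<lambda>f. (\<lambda>z. - fst f z, \<lambda>z. - snd f z)"
  by (auto intro!: holomorphic_intros tendsto_minus_cancel_left[THEN iffD1])

definition minus_hyperfunction :: "hyperfunction \<Rightarrow> hyperfunction \<Rightarrow> hyperfunction"
  where "f - g = f + (- g)" for f g :: hyperfunction

instance
proof
  fix a b c :: hyperfunction
  show "a + b + c = a + (b + c)" by transfer (simp add: add.assoc)
  show "a + b = b + a" by transfer (simp add: add.commute)
  show "0 + a = a" by transfer simp
  show "- a + a = 0" by transfer simp
  show "a - b = a + - b" by (fact minus_hyperfunction_def)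
qed

end

lift_definition hscale :: "complex \<Rightarrow> hyperfunction \<Rightarrow> hyperfunction"
  is "\<lambda>c f. (\<lambda>z. c * fst f z, \<lambda>z. c * snd f z)"
  by (auto intro!: holomorphic_intros tendsto_mult_right_zero)

global_interpretation hf: vector_space hscale
proof
  fix a b :: complex and x y :: hyperfunction
  show "hscale a (x + y) = hscale a x + hscale a y" by transfer (simp add: distrib_left)
  show "hscale (a + b) x = hscale a x + hscale b x" by transfer (simp add: distrib_right)
  show "hscale a (hscale b x) = hscale (a * b) x" by transfer (simp add: mult.assoc)
  show "hscale 1 x = x" by transfer simp
qed

lemma hplus_holomorphic: "hplus f holomorphic_on ball 0 1"
  and hplus_outside: "z \<notin> ball 0 1 \<Longrightarrow> hplus f z = 0"
  and hminus_holomorphic: "hminus f holomorphic_on (- cball 0 1)"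
  and hminus_inside: "z \<in> cball 0 1 \<Longrightarrow> hminus f z = 0"
  and hminus_tendsto: "(hminus f \<longlongrightarrow> 0) at_infinity"
  using Rep_hyperfunction[of f] by (auto simp: hplus.rep_eq hminus.rep_eq)

lemma hyperfunction_eqI:
  assumes "\<And>z. z \<in> ball 0 1 \<Longrightarrow> hplus f z = hplus g z"
    and "\<And>z. z \<notin> cball 0 1 \<Longrightarrow> hminus f z = hminus g z"
  shows "f = g"
proof -
  have "hplus f z = hplus g z" for z
    using assms(1)[of z] hplus_outside[of z] by (cases "z \<in> ball 0 1") simp_all
  moreover have "hminus f z = hminus g z" for z
    using assms(2)[of z] hminus_inside[of z] by (cases "z \<in> cball 0 1") simp_all
  ultimately show ?thesis
    by (simp add: Rep_hyperfunction_inject[symmetric] prod_eq_iff fun_eq_iff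
        hplus.rep_eq hminus.rep_eq)
qed

section \<open>Fourier coefficients\<close>

definition is_fourier :: "hyperfunction \<Rightarrow> (int \<Rightarrow> complex) \<Rightarrow> bool"
  where "is_fourier f a \<longleftrightarrow>
    (\<forall>z. norm z < 1 \<longrightarrow> (\<lambda>n. a (int n) * z ^ n) sums hplus f z) \<and>
    (\<forall>z. norm z > 1 \<longrightarrow> (\<lambda>n. a (- int (Suc n)) * z powi (- int (Suc n))) sums hminus f z)"

definition fourier :: "hyperfunction \<Rightarrow> int \<Rightarrow> complex"
  where "fourier f = (THE a. is_fourier f a)"

lemma powser_unique:
  fixes a b :: "nat \<Rightarrow> complex"
  assumes "\<And>z. norm z < 1 \<Longrightarrow> (\<lambda>n. a n * z ^ n) sums h z"
    and "\<And>z. norm z < 1 \<Longrightarrow> (\<lambda>n. b n * z ^ n) sums h z"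
  shows "a = b"
proof -
  have r: "fps_conv_radius (Abs_fps c) > 0"
    if "\<And>z. norm z < 1 \<Longrightarrow> (\<lambda>n. c n * z ^ n) sums h z" for c
  proof -
    have "summable (\<lambda>n. c n * (1/2) ^ n)"
      using that[of "1/2"] by (auto simp: sums_iff)
    from conv_radius_geI[OF this] have "conv_radius c \<ge> ereal (1/2)" by simp
    then have "conv_radius c > 0"
      by (rule less_le_trans[rotated]) simp
    then show ?thesis by (simp add: fps_conv_radius_def)
  qed
  have ev: "eventually (\<lambda>z::complex. norm z < 1) (nhds 0)"
    using eventually_nhds_in_open[of "ball 0 (1::real)" "0::complex"] by simp
  have "Abs_fps a = Abs_fps b"
    by (rule eval_fps_eqD[OF r r])
      (use assms in \<open>auto simp: eval_fps_def sums_iff intro!: eventually_mono[OF ev]\<close>)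
  then show ?thesis by (simp add: Abs_fps_inject)
qed

lemma exterior_series_iff:
  fixes c :: "nat \<Rightarrow> complex"
  shows
  "(\<forall>z. norm z > 1 \<longrightarrow> (\<lambda>n. c n * z powi (- int (Suc n))) sums h z) \<longleftrightarrow>
   (\<forall>w. norm w < 1 \<longrightarrow> w \<noteq> 0 \<longrightarrow> (\<lambda>n. c n * w ^ Suc n) sums h (inverse w))"
proof -
  have [simp]: "z powi (- int (Suc n)) = inverse z ^ Suc n" for z :: complex and n
    by (simp add: power_int_minus power_int_def del: of_nat_Suc power_Suc flip: power_inverse)
  show ?thesis
  proof (intro iffI allI impI)
    fix w :: complex
    assume "\<forall>z. norm z > 1 \<longrightarrow> (\<lambda>n. c n * z powi (- int (Suc n))) sums h z"
      and w: "norm w < 1" "w \<noteq> 0"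
    moreover have "norm (inverse w) > 1"
      using w by (simp add: norm_inverse one_less_inverse)
    ultimately have "(\<lambda>n. c n * inverse w powi (- int (Suc n))) sums h (inverse w)"
      by blast
    then show "(\<lambda>n. c n * w ^ Suc n) sums h (inverse w)"
      by (simp del: of_nat_Suc power_Suc)
  next
    fix z :: complex
    assume *: "\<forall>w. norm w < 1 \<longrightarrow> w \<noteq> 0 \<longrightarrow> (\<lambda>n. c n * w ^ Suc n) sums h (inverse w)"
      and z: "norm z > 1"
    have "norm (inverse z) < 1" "inverse z \<noteq> 0"
      using z by (auto simp: norm_inverse inverse_less_1_iff)
    with * have "(\<lambda>n. c n * inverse z ^ Suc n) sums h (inverse (inverse z))"
      by blast
    then show "(\<lambda>n. c n * z powi (- int (Suc n))) sums h z"
      by (simp del: of_nat_Suc power_Suc)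
  qed
qed

lemma hminus_inverse_expansion:
  obtains c where "\<And>w. norm w < 1 \<Longrightarrow> w \<noteq> 0 \<Longrightarrow> (\<lambda>n. c n * w ^ Suc n) sums hminus f (inverse w)"
    and "((\<lambda>z. z * hminus f z) \<longlongrightarrow> c 0) at_infinity"
proof -
  define g where "g = (\<lambda>w. if w = 0 then 0 else hminus f (inverse w))"
  have lim: "(g \<longlongrightarrow> g 0) (at 0)"
  proof -
    have "((\<lambda>w. hminus f (inverse w)) \<longlongrightarrow> 0) (at 0)"
      by (rule filterlim_compose[OF hminus_tendsto filterlim_inverse_at_infinity])
    moreover have "eventually (\<lambda>w::complex. hminus f (inverse w) = g w) (at 0)"
      by (auto simp: eventually_at_filter g_def)
    ultimately have "(g \<longlongrightarrow> 0) (at 0)"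
      by (rule Lim_transform_eventually)
    moreover have "g 0 = 0" by (simp add: g_def)
    ultimately show ?thesis by simp
  qed
  have "(hminus f \<circ> inverse) holomorphic_on (ball 0 1 - {0})"
  proof (rule holomorphic_on_compose_gen[OF _ hminus_holomorphic])
    show "inverse holomorphic_on (ball (0::complex) 1 - {0})"
      by (intro holomorphic_intros) auto
    show "inverse ` (ball (0::complex) 1 - {0}) \<subseteq> - cball 0 1"
      by (auto simp: norm_inverse inverse_le_1_iff)
  qed
  then have "g holomorphic_on (ball 0 1 - {0})"
    by (rule holomorphic_transform) (auto simp: g_def)
  then have hol: "g holomorphic_on ball 0 1"
    by (rule no_isolated_singularity'[rotated])
      (use lim in \<open>auto intro: tendsto_within_subset\<close>)
  define b where "b n = (deriv ^^ n) g 0 / fact n" for n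
  have b: "(\<lambda>n. b n * w ^ n) sums g w" if "norm w < 1" for w
    using holomorphic_power_series[OF hol, of w] that by (simp add: b_def)
  have b0: "b 0 = 0" by (simp add: b_def g_def)
  show ?thesis
  proof (rule that[of "\<lambda>n. b (Suc n)"])
    fix w :: complex
    assume w: "norm w < 1" "w \<noteq> 0"
    then show "(\<lambda>n. b (Suc n) * w ^ Suc n) sums hminus f (inverse w)"
      using b[of w] b0 sums_Suc_iff[of "\<lambda>n. b n * w ^ n" "g w"] by (simp add: g_def)
  next
    have "(g has_field_derivative deriv g 0) (at 0)"
      by (rule holomorphic_derivI[OF hol]) auto
    then have "((\<lambda>w. g w / w) \<longlongrightarrow> deriv g 0) (at 0)"
      by (simp add: has_field_derivative_iff g_def)
    moreover have "filterlim inverse (at (0::complex)) at_infinity"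
      by (simp add: filterlim_inverse_at_iff filterlim_ident)
    ultimately have "((\<lambda>z. g (inverse z) / inverse z) \<longlongrightarrow> deriv g 0) at_infinity"
      by (rule filterlim_compose)
    moreover have "eventually (\<lambda>z::complex. g (inverse z) / inverse z = z * hminus f z) at_infinity"
      using eventually_not_equal_at_infinity[of 0]
      by eventually_elim (simp add: g_def field_simps)
    ultimately show "((\<lambda>z. z * hminus f z) \<longlongrightarrow> b (Suc 0)) at_infinity"
      by (simp add: b_def filterlim_cong[OF refl refl])
  qed
qed

lemma fourier_ex1: "\<exists>!a. is_fourier f a"
proof (rule ex_ex1I)
  obtain c where "\<forall>w. norm w < 1 \<longrightarrow> w \<noteq> 0 \<longrightarrow> (\<lambda>n. c n * w ^ Suc n) sums hminus f (inverse w)"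
    using hminus_inverse_expansion by metis
  then have c: "\<forall>z. norm z > 1 \<longrightarrow> (\<lambda>n. c n * z powi (- int (Suc n))) sums hminus f z"
    unfolding exterior_series_iff .
  define a where "a k = (if k \<ge> 0 then (deriv ^^ nat k) (hplus f) 0 / fact (nat k)
    else c (nat (- k) - 1))" for k :: int
  have "(\<lambda>n. a (int n) * z ^ n) sums hplus f z" if "norm z < 1" for z
    using holomorphic_power_series[OF hplus_holomorphic, of z f] that by (simp add: a_def)
  moreover have "a (- int (Suc n)) = c n" for n
    by (simp add: a_def del: of_nat_Suc)
  ultimately show "\<exists>a. is_fourier f a"
    using c unfolding is_fourier_def by (intro exI[of _ a]) (simp del: of_nat_Suc)
next
  fix a b
  assume ab: "is_fourier f a" "is_fourier f b"
  have 1: "(\<lambda>n. a (int n)) = (\<lambda>n. b (int n))"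
    by (rule powser_unique[of _ "hplus f"]) (use ab in \<open>auto simp: is_fourier_def\<close>)
  have ext: "(\<lambda>n. (if n = 0 then 0 else e (- int n)) * w ^ n) sums
      (if w = 0 then 0 else hminus f (inverse w))"
    if "is_fourier f e" "norm w < 1" for e and w :: complex
  proof (cases "w = 0")
    case True
    have "(\<lambda>n. (if n = 0 then 0 else e (- int n)) * w ^ n) = (\<lambda>_. 0)"
      using True by (auto simp: fun_eq_iff)
    with True show ?thesis by simp
  next
    case False
    have "\<forall>w. norm w < 1 \<longrightarrow> w \<noteq> 0 \<longrightarrow>
        (\<lambda>n. e (- int (Suc n)) * w ^ Suc n) sums hminus f (inverse w)"
      using that(1) unfolding is_fourier_def exterior_series_iff by blast
    with False that(2) have "(\<lambda>n. e (- int (Suc n)) * w ^ Suc n) sums hminus f (inverse w)"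
      by blast
    with False show ?thesis
      using sums_Suc_iff[of "\<lambda>n. (if n = 0 then 0 else e (- int n)) * w ^ n"]
      by (simp del: of_nat_Suc power_Suc)
  qed
  have 2: "(\<lambda>n. if n = 0 then 0 else a (- int n)) = (\<lambda>n. if n = 0 then 0 else b (- int n))"
    by (rule powser_unique[OF ext[OF ab(1)] ext[OF ab(2)]])
  show "a = b"
  proof
    fix k :: int
    show "a k = b k"
    proof (cases "k \<ge> 0")
      case True
      then show ?thesis using fun_cong[OF 1, of "nat k"] by simp
    next
      case False
      then show ?thesis using fun_cong[OF 2, of "nat (- k)"] by simp
    qed
  qed
qed

lemma is_fourier_fourier: "is_fourier f (fourier f)"
  unfolding fourier_def by (rule theI'[OF fourier_ex1])

lemma fourier_eqI: "is_fourier f a \<Longrightarrow> fourier f = a"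
  using fourier_ex1 is_fourier_fourier by blast

lemma fourier_inject: "fourier f = fourier g \<longleftrightarrow> f = g"
proof
  assume "fourier f = fourier g"
  then have 1: "is_fourier f (fourier g)"
    by (metis is_fourier_fourier)
  have 2: "is_fourier g (fourier g)"
    by (rule is_fourier_fourier)
  show "f = g"
  proof (rule hyperfunction_eqI)
    fix z :: complex
    assume "z \<in> ball 0 1"
    then show "hplus f z = hplus g z"
      using 1 2 sums_unique2 unfolding is_fourier_def by (metis mem_ball_0)
  next
    fix z :: complex
    assume "z \<notin> cball 0 1"
    then have "norm z > 1" by simp
    then show "hminus f z = hminus g z"
      using 1 2 sums_unique2 unfolding is_fourier_def by metis
  qed
qed simp

section \<open>Shifts and the projection onto the analytic part\<close>

definition bshift :: "hyperfunction \<Rightarrow> hyperfunction"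
  where "bshift f = (THE g. \<forall>n. fourier g n = fourier f (n - 1))"

definition holD :: "hyperfunction set"
  where "holD = {f. \<forall>z. hminus f z = 0}"

lift_definition Pplus :: "hyperfunction \<Rightarrow> hyperfunction" is "\<lambda>f. (fst f, \<lambda>_. 0)"
  by auto

lift_definition hone :: hyperfunction is "(\<lambda>z. if z \<in> ball 0 1 then 1 else 0, \<lambda>_. 0)"
  by (auto intro: holomorphic_transform[OF holomorphic_on_const])

text \<open>The shift \<open>S f(z) = z f(z)\<close>, meant for elements of \<open>holD\<close>.\<close>

lift_definition ushift :: "hyperfunction \<Rightarrow> hyperfunction" is "\<lambda>f. (\<lambda>z. z * fst f z, \<lambda>_. 0)"
  by (auto intro!: holomorphic_intros)

lemma bshift_ex1: "\<exists>!g. \<forall>n. fourier g n = fourier f (n - 1)"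
proof (rule ex_ex1I)
  define a where "a = fourier f"
  obtain c where c: "\<forall>w. norm w < 1 \<longrightarrow> w \<noteq> 0 \<longrightarrow>
      (\<lambda>n. c n * w ^ Suc n) sums hminus f (inverse w)"
    and lim: "((\<lambda>z. z * hminus f z) \<longlongrightarrow> c 0) at_infinity"
    using hminus_inverse_expansion[of f] by metis
  have fa: "is_fourier f a" by (simp add: a_def is_fourier_fourier)
  have "is_fourier f (\<lambda>k. if k \<ge> 0 then a k else c (nat (- k) - 1))"
    using fa c[folded exterior_series_iff] by (simp add: is_fourier_def del: of_nat_Suc)
  then have "(\<lambda>k. if k \<ge> 0 then a k else c (nat (- k) - 1)) = a"
    unfolding a_def by (rule fourier_eqI[symmetric])
  from fun_cong[OF this, of "- 1"] have c0: "c 0 = a (- 1)" by simp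
  define p where "p = (\<lambda>z. if z \<in> ball 0 1 then z * hplus f z + a (- 1) else 0)"
  define m where "m = (\<lambda>z. if z \<in> cball 0 1 then 0 else z * hminus f z - a (- 1))"
  have p: "p holomorphic_on ball 0 1"
    by (rule holomorphic_transform[of "\<lambda>z. z * hplus f z + a (- 1)"])
      (auto simp: p_def intro!: holomorphic_intros hplus_holomorphic)
  have m: "m holomorphic_on (- cball 0 1)"
    by (rule holomorphic_transform[of "\<lambda>z. z * hminus f z - a (- 1)"])
      (auto simp: m_def intro!: holomorphic_intros hminus_holomorphic)
  have "eventually (\<lambda>z::complex. 2 \<le> norm z) at_infinity"
    by (auto simp: eventually_at_infinity)
  then have "eventually (\<lambda>z. z * hminus f z - a (- 1) = m z) at_infinity"
    by eventually_elim (auto simp: m_def)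
  moreover have "((\<lambda>z. z * hminus f z - a (- 1)) \<longlongrightarrow> 0) at_infinity"
    using lim c0 by (simp add: LIM_zero)
  ultimately have mlim: "(m \<longlongrightarrow> 0) at_infinity"
    by (rule Lim_transform_eventually[rotated])
  have "(p, m) \<in> {(f, g). f holomorphic_on ball 0 1 \<and> (\<forall>z. z \<notin> ball 0 1 \<longrightarrow> f z = 0) \<and>
      g holomorphic_on (- cball 0 1) \<and> (\<forall>z\<in>cball 0 1. g z = 0) \<and> (g \<longlongrightarrow> 0) at_infinity}"
    using p m mlim by (auto simp: p_def m_def)
  from Abs_hyperfunction_inverse[OF this] obtain g where g: "hplus g = p" "hminus g = m"
    by (intro that[of "Abs_hyperfunction (p, m)"]) (simp_all add: hplus.rep_eq hminus.rep_eq)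
  have "is_fourier g (\<lambda>n. a (n - 1))"
    unfolding is_fourier_def
  proof (intro conjI allI impI)
    fix z :: complex
    assume z: "norm z < 1"
    then have "(\<lambda>n. z * (a (int n) * z ^ n)) sums (z * hplus f z)"
      using fa by (intro sums_mult) (auto simp: is_fourier_def)
    then have "(\<lambda>n. a (int (Suc n) - 1) * z ^ Suc n) sums (z * hplus f z)"
      by (simp add: mult_ac)
    then show "(\<lambda>n. a (int n - 1) * z ^ n) sums hplus g z"
      using z sums_Suc[of "\<lambda>n. a (int n - 1) * z ^ n" "z * hplus f z"] by (simp add: g p_def)
  next
    fix z :: complex
    assume z: "norm z > 1"
    then have "(\<lambda>n. z * (a (- int (Suc n)) * z powi (- int (Suc n)))) sums (z * hminus f z)"
      using fa by (intro sums_mult) (auto simp: is_fourier_def)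
    moreover have "z * (a (- int (Suc n)) * z powi (- int (Suc n))) =
        a (- int (Suc n)) * z powi (- int n)" for n
    proof -
      have "z \<noteq> 0" using z by auto
      then have "z powi (- int (Suc n) + 1) = z * z powi (- int (Suc n))"
        by (intro power_int_add_1') auto
      moreover have "- int (Suc n) + 1 = - int n" by simp
      ultimately show ?thesis by (simp only: mult_ac)
    qed
    ultimately have "(\<lambda>n. a (- int (Suc n)) * z powi (- int n)) sums (z * hminus f z)"
      by (simp del: of_nat_Suc)
    then have "(\<lambda>n. a (- int (Suc (Suc n))) * z powi (- int (Suc n))) sums (z * hminus f z - a (- 1))"
      using sums_Suc_iff[of "\<lambda>n. a (- int (Suc n)) * z powi (- int n)"] by simp
    moreover have "- int (Suc n) - 1 = - int (Suc (Suc n))" for n by simp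
    ultimately show "(\<lambda>n. a (- int (Suc n) - 1) * z powi (- int (Suc n))) sums hminus g z"
      using z by (simp only: g m_def) simp
  qed
  then show "\<exists>g. \<forall>n. fourier g n = fourier f (n - 1)"
    by (intro exI[of _ g]) (simp add: fourier_eqI a_def)
next
  fix g h
  assume "\<forall>n. fourier g n = fourier f (n - 1)" "\<forall>n. fourier h n = fourier f (n - 1)"
  then have "fourier g = fourier h" by auto
  then show "g = h" by (simp add: fourier_inject)
qed

lemma fourier_bshift: "fourier (bshift f) n = fourier f (n - 1)"
  using theI'[OF bshift_ex1[of f]] unfolding bshift_def by blast

section \<open>Banach spaces of hyperfunctions\<close>

text \<open>
  A normed space inside the hyperfunctions is a pair of a carrier \<open>F\<close> and a function \<open>N\<close>
  whose values matter on \<open>F\<close> only.  The locale \<open>Metric_space\<close> asks for a distance that is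
  nonnegative and symmetric off the carrier too, hence the case distinction.
\<close>

definition hf_dist ::
  "hyperfunction set \<Rightarrow> (hyperfunction \<Rightarrow> real) \<Rightarrow> hyperfunction \<Rightarrow> hyperfunction \<Rightarrow> real"
  where "hf_dist F N f g = (if f \<in> F \<and> g \<in> F then N (f - g) else 0)"

definition hf_topology ::
  "hyperfunction set \<Rightarrow> (hyperfunction \<Rightarrow> real) \<Rightarrow> hyperfunction topology"
  where "hf_topology F N = Metric_space.mtopology F (hf_dist F N)"

definition hf_normed :: "hyperfunction set \<Rightarrow> (hyperfunction \<Rightarrow> real) \<Rightarrow> bool"
  where "hf_normed F N \<longleftrightarrow> hf.subspace F \<and>
    (\<forall>f\<in>F. 0 \<le> N f) \<and> (\<forall>f\<in>F. N f = 0 \<longleftrightarrow> f = 0) \<and>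
    (\<forall>c. \<forall>f\<in>F. N (hscale c f) = norm c * N f) \<and>
    (\<forall>f\<in>F. \<forall>g\<in>F. N (f + g) \<le> N f + N g)"

definition hf_banach :: "hyperfunction set \<Rightarrow> (hyperfunction \<Rightarrow> real) \<Rightarrow> bool"
  where "hf_banach F N \<longleftrightarrow> hf_normed F N \<and> Metric_space.mcomplete F (hf_dist F N)"

lemma Metric_space_hf_dist:
  assumes "hf_normed F N"
  shows "Metric_space F (hf_dist F N)"
proof
  have sub: "hf.subspace F" and nn: "\<And>f. f \<in> F \<Longrightarrow> 0 \<le> N f"
    and z: "\<And>f. f \<in> F \<Longrightarrow> N f = 0 \<longleftrightarrow> f = 0"
    and sc: "\<And>c f. f \<in> F \<Longrightarrow> N (hscale c f) = norm c * N f"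
    and tri: "\<And>f g. f \<in> F \<Longrightarrow> g \<in> F \<Longrightarrow> N (f + g) \<le> N f + N g"
    using assms by (auto simp: hf_normed_def)
  have diff: "f - g \<in> F" if "f \<in> F" "g \<in> F" for f g
    using sub that by (rule hf.subspace_diff)
  show "0 \<le> hf_dist F N x y" for x y
    by (simp add: hf_dist_def nn diff)
  show "hf_dist F N x y = hf_dist F N y x" for x y
    using sc[of "x - y" "- 1"] diff[of x y] by (auto simp: hf_dist_def)
  show "hf_dist F N x y = 0 \<longleftrightarrow> x = y" if "x \<in> F" "y \<in> F" for x y
    using that by (simp add: hf_dist_def z diff)
  show "hf_dist F N x u \<le> hf_dist F N x y + hf_dist F N y u"
    if "x \<in> F" "y \<in> F" "u \<in> F" for x y u
    using tri[of "x - y" "y - u"] that by (simp add: hf_dist_def diff)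
qed

definition hf_bounded_op ::
  "hyperfunction set \<Rightarrow> (hyperfunction \<Rightarrow> real) \<Rightarrow> (hyperfunction \<Rightarrow> hyperfunction) \<Rightarrow> bool"
  where "hf_bounded_op F N T \<longleftrightarrow> T ` F \<subseteq> F \<and>
    (\<forall>f\<in>F. \<forall>g\<in>F. T (f + g) = T f + T g) \<and> (\<forall>c. \<forall>f\<in>F. T (hscale c f) = hscale c (T f)) \<and>
    continuous_map (hf_topology F N) (hf_topology F N) T"

definition hf_spectrum ::
  "hyperfunction set \<Rightarrow> (hyperfunction \<Rightarrow> real) \<Rightarrow> (hyperfunction \<Rightarrow> hyperfunction) \<Rightarrow> complex set"
  where "hf_spectrum F N T = {c. \<not> (\<exists>R. hf_bounded_op F N R \<and>
    (\<forall>f\<in>F. R (hscale c f - T f) = f \<and> hscale c (R f) - T (R f) = f))}"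

definition hf_class :: "hyperfunction set \<Rightarrow> (hyperfunction \<Rightarrow> real) \<Rightarrow> bool"
  where "hf_class F N \<longleftrightarrow> hf_banach F N \<and> F \<noteq> {0} \<and>
    Pplus ` F \<subseteq> F \<and> continuous_map (hf_topology F N) (hf_topology F N) Pplus \<and>
    bshift ` F \<subseteq> F \<and> continuous_map (hf_topology F N) (hf_topology F N) bshift \<and>
    hf_spectrum F N bshift \<subseteq> sphere 0 1"

text \<open>The inverse of the bilateral shift as an operator on \<open>F\<close>, for \<open>F\<close> with \<open>hf_class F N\<close>.\<close>

definition bshift_inv :: "hyperfunction set \<Rightarrow> hyperfunction \<Rightarrow> hyperfunction"
  where "bshift_inv F = inv_into F bshift"

definition division_property :: "hyperfunction set \<Rightarrow> complex \<Rightarrow> bool"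
  where "division_property M c \<longleftrightarrow> (\<forall>f\<in>M. hplus f c = 0 \<longrightarrow>
    (\<exists>g\<in>M. \<forall>z\<in>ball 0 1 - {c}. hplus g z = hplus f z / (z - c)))"

definition dual_norm ::
  "hyperfunction set \<Rightarrow> (hyperfunction \<Rightarrow> real) \<Rightarrow> (hyperfunction \<Rightarrow> complex) \<Rightarrow> real"
  where "dual_norm F N L = (SUP f\<in>{f \<in> F. N f \<le> 1}. norm (L f))"

section \<open>Quotient spaces\<close>

text \<open>
  The canonical surjection of \<open>W\<close> onto \<open>W / M\<close> sends \<open>f\<close> to the coset \<open>f +o M\<close>. The sum of two
  cosets is the sum of sets. In \<open>coset_scale\<close> the summand \<open>M\<close> matters only for \<open>c = 0\<close>.
\<close>

definition quot_space :: "hyperfunction set \<Rightarrow> hyperfunction set \<Rightarrow> hyperfunction set set"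
  where "quot_space W M = (\<lambda>f. f +o M) ` W"

definition coset_scale ::
  "hyperfunction set \<Rightarrow> complex \<Rightarrow> hyperfunction set \<Rightarrow> hyperfunction set"
  where "coset_scale M c A = hscale c ` A + M"

definition quot_norm :: "(hyperfunction \<Rightarrow> real) \<Rightarrow> hyperfunction set \<Rightarrow> real"
  where "quot_norm N A = (INF f\<in>A. N f)"

definition quot_linear ::
  "hyperfunction set \<Rightarrow> hyperfunction set \<Rightarrow> (hyperfunction set \<Rightarrow> hyperfunction set) \<Rightarrow> bool"
  where "quot_linear W M U \<longleftrightarrow> U ` quot_space W M \<subseteq> quot_space W M \<and>
    (\<forall>A\<in>quot_space W M. \<forall>B\<in>quot_space W M. U (A + B) = U A + U B) \<and>
    (\<forall>c. \<forall>A\<in>quot_space W M. U (coset_scale M c A) = coset_scale M c (U A))"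

end

theory Submission
  imports Defs
begin

text \<open>
  Write \<open>T\<close> for the inverse of the bilateral shift on \<open>F\<close>, \<open>N0\<close> for the span of the spaces
  \<open>T^p M\<close> and \<open>F\<^sup>+\<close> for the analytic part of \<open>F\<close>. Three facts carry the proof.

  The algebraic fact \<open>N0_Int_holD\<close>: \<open>N0\<close> contains no analytic functions besides those of \<open>M\<close>,
  because in an analytic sum of terms \<open>T^j m\<close> the term with the largest \<open>j\<close> has \<open>m(0) = 0\<close>, and
  dividing \<open>m\<close> by \<open>z\<close> lowers \<open>j\<close>.

  The meaning of \<open>U0\<close>, \<open>U0_power\<close>: some element of \<open>M\<close> takes the value \<open>1\<close> at \<open>0\<close>, so up to \<open>M\<close>
  every \<open>h\<close> in \<open>F\<^sup>+\<close> is divisible by \<open>z\<close>; hence \<open>T^k h\<close> agrees modulo \<open>N0\<close> with any representative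
  of \<open>U0^k \<pi>(h)\<close>. In particular the span of the \<open>T^p F\<^sup>+\<close> is \<open>N0 + F\<^sup>+\<close> (\<open>span_funpow_T_Fp\<close>).

  The estimate \<open>distance_estimate\<close>: for some constant \<open>C\<close>, the distance of \<open>h\<close> to \<open>M\<close> is at most
  \<open>C\<close> times the norm of \<open>n + h\<close>, for all \<open>n\<close> in \<open>N0\<close> and \<open>h\<close> in \<open>F\<^sup>+\<close>. Indeed \<open>f = n + h\<close> is the
  sum of \<open>P\<^sup>+ f\<close> and finitely many terms \<open>L\<^bsub>-k\<^esub>(f) T^k 1\<close>. Replacing \<open>T^k 1\<close> by a nearly minimal
  representative of \<open>U0^k \<pi>(1)\<close> yields an element of \<open>F\<^sup>+\<close> that differs from \<open>h\<close> by an element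
  of \<open>N0\<close>, hence of \<open>M\<close>, and the summability hypothesis bounds its norm.

  The estimate says that the map sending \<open>n + h\<close> to \<open>\<pi>(h)\<close> is bounded. A function of \<open>F\<^sup>+\<close> in the
  closure of \<open>N0\<close> is therefore at distance \<open>0\<close> from the closed space \<open>M\<close>. If \<open>n + h\<close> runs through
  approximants of a point \<open>f\<close> of the closure of \<open>N0 + F\<^sup>+\<close>, the summands \<open>h\<close> can be corrected by
  elements of \<open>M\<close> so as to form a Cauchy sequence; its limit \<open>g\<close> lies in \<open>F\<^sup>+\<close>, and \<open>f - g\<close> is
  the limit of the corrected \<open>n\<close>.
\<close>

section \<open>Fourier coefficients and linear operations\<close>

lemma hyperfunction_fourier_eqI: "(\<And>n. fourier f n = fourier g n) \<Longrightarrow> f = g"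
  using fourier_inject[of f g] by auto

lemma hplus_add: "hplus (f + g) z = hplus f z + hplus g z"
  and hminus_add: "hminus (f + g) z = hminus f z + hminus g z"
  by (transfer, simp)+

lemma hplus_hscale: "hplus (hscale c f) z = c * hplus f z"
  and hminus_hscale: "hminus (hscale c f) z = c * hminus f z"
  by (transfer, simp)+

lemma hplus_Pplus: "hplus (Pplus f) = hplus f"
  and hminus_Pplus: "hminus (Pplus f) z = 0"
  by (transfer, simp)+

lemma fourier_add: "fourier (f + g) n = fourier f n + fourier g n"
proof -
  have "is_fourier (f + g) (\<lambda>n. fourier f n + fourier g n)"
    using is_fourier_fourier[of f] is_fourier_fourier[of g]
    unfolding is_fourier_def by (auto simp: hplus_add hminus_add distrib_right intro!: sums_add)
  from fourier_eqI[OF this] show ?thesis by simp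
qed

lemma fourier_hscale: "fourier (hscale c f) n = c * fourier f n"
proof -
  have "is_fourier (hscale c f) (\<lambda>n. c * fourier f n)"
    using is_fourier_fourier[of f]
    unfolding is_fourier_def by (auto simp: hplus_hscale hminus_hscale mult.assoc intro!: sums_mult)
  from fourier_eqI[OF this] show ?thesis by simp
qed

lemma fourier_zero: "fourier 0 n = 0"
  using fourier_hscale[of 0 0 n] by simp

lemma fourier_uminus: "fourier (- f) n = - fourier f n"
  using fourier_add[of f "- f" n] by (simp add: fourier_zero eq_neg_iff_add_eq_0 add.commute)

lemma fourier_diff: "fourier (f - g) n = fourier f n - fourier g n"
  using fourier_add[of f "- g" n] by (simp add: fourier_uminus)

lemma fourier_sum: "fourier (sum g I) n = (\<Sum>i\<in>I. fourier (g i) n)"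
  by (induction I rule: infinite_finite_induct) (auto simp: fourier_zero fourier_add)

lemma fourier_Pplus: "fourier (Pplus f) n = (if n \<ge> 0 then fourier f n else 0)"
proof -
  have "is_fourier (Pplus f) (\<lambda>n. if n \<ge> 0 then fourier f n else 0)"
    using is_fourier_fourier[of f]
    unfolding is_fourier_def by (auto simp: hplus_Pplus hminus_Pplus)
  from fourier_eqI[OF this] show ?thesis by simp
qed

lemma fourier_hone: "fourier hone n = (if n = 0 then 1 else 0)"
proof -
  have p: "hplus hone z = (if z \<in> ball 0 1 then 1 else 0)" for z
    by transfer simp
  have m: "hminus hone z = 0" for z by transfer simp
  have "(\<lambda>n. (if n = 0 then 1 else 0) * z ^ n) sums 1" for z :: complex
    using sums_If_finite_set[of "{0::nat}" "\<lambda>n. z ^ n"]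
    by (auto simp: if_distrib[of "\<lambda>x. x * _"] cong: if_cong)
  then have "is_fourier hone (\<lambda>n. if n = 0 then 1 else 0)"
    unfolding is_fourier_def by (auto simp: p m simp del: of_nat_Suc)
  from fourier_eqI[OF this] show ?thesis by simp
qed

lemma hplus_at_0: "hplus f 0 = fourier f 0"
proof -
  have "(\<lambda>n. fourier f (int n) * 0 ^ n) sums hplus f 0"
    using is_fourier_fourier[of f] unfolding is_fourier_def by (metis norm_zero zero_less_one)
  from sums_unique2[OF this powser_sums_zero] show ?thesis by (simp only: of_nat_0)
qed

lemma holD_iff: "f \<in> holD \<longleftrightarrow> (\<forall>n<0. fourier f n = 0)"
proof -
  have "f \<in> holD \<longleftrightarrow> Pplus f = f"
  proof
    assume "f \<in> holD"
    then show "Pplus f = f"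
      by (intro hyperfunction_eqI) (auto simp: holD_def hplus_Pplus hminus_Pplus)
  next
    assume "Pplus f = f"
    then show "f \<in> holD"
      using hminus_Pplus[of f] by (auto simp: holD_def)
  qed
  also have "\<dots> \<longleftrightarrow> (\<forall>n<0. fourier f n = 0)"
    by (auto simp: fourier_inject[symmetric] fun_eq_iff fourier_Pplus)
  finally show ?thesis .
qed

lemma subspace_holD: "hf.subspace holD"
  by (auto simp: hf.subspace_def holD_iff fourier_zero fourier_add fourier_hscale)

lemma Pplus_in_holD: "Pplus f \<in> holD"
  by (simp add: holD_iff fourier_Pplus)

lemma ushift_eq_bshift:
  assumes "f \<in> holD"
  shows "ushift f = bshift f"
proof (rule hyperfunction_fourier_eqI)
  have p: "hplus (ushift f) z = z * hplus f z" and m: "hminus (ushift f) z = 0" for z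
    by (transfer, simp)+
  have *: "is_fourier (ushift f) (\<lambda>n. fourier f (n - 1))"
    unfolding is_fourier_def
  proof (intro conjI allI impI)
    fix z :: complex
    assume z: "norm z < 1"
    have "(\<lambda>n. z * (fourier f (int n) * z ^ n)) sums (z * hplus f z)"
      using is_fourier_fourier[of f] z by (intro sums_mult) (auto simp: is_fourier_def)
    then have "(\<lambda>n. fourier f (int (Suc n) - 1) * z ^ Suc n) sums (z * hplus f z)"
      by (simp add: mult_ac)
    then show "(\<lambda>n. fourier f (int n - 1) * z ^ n) sums hplus (ushift f) z"
      using sums_Suc[of "\<lambda>n. fourier f (int n - 1) * z ^ n" "z * hplus f z"] assms
      by (simp add: p holD_iff)
  next
    fix z :: complex
    show "(\<lambda>n. fourier f (- int (Suc n) - 1) * z powi (- int (Suc n))) sums hminus (ushift f) z"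
      using assms by (simp add: m holD_iff)
  qed
  show "fourier (ushift f) n = fourier (bshift f) n" for n
    by (simp add: fourier_eqI[OF *] fourier_bshift)
qed

lemma bshift_add: "bshift (f + g) = bshift f + bshift g"
  by (rule hyperfunction_fourier_eqI) (simp add: fourier_bshift fourier_add)

lemma bshift_hscale: "bshift (hscale c f) = hscale c (bshift f)"
  by (rule hyperfunction_fourier_eqI) (simp add: fourier_bshift fourier_hscale)

lemma Pplus_add: "Pplus (f + g) = Pplus f + Pplus g"
  by (rule hyperfunction_fourier_eqI) (simp add: fourier_Pplus fourier_add)

lemma Pplus_hscale: "Pplus (hscale c f) = hscale c (Pplus f)"
  by (rule hyperfunction_fourier_eqI) (simp add: fourier_Pplus fourier_hscale)

lemma inj_bshift: "bshift f = bshift g \<Longrightarrow> f = g"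
  by (rule hyperfunction_fourier_eqI) (metis fourier_bshift add_diff_cancel)

text \<open>Every hyperfunction whose Fourier coefficients vanish below \<open>- p\<close> is the sum of its
  analytic part and of a polynomial in \<open>1 / z\<close>.\<close>

lemma eq_Pplus_add_sum:
  assumes "\<And>n. n < - int p \<Longrightarrow> fourier f n = 0"
    and "\<And>k n. fourier (e k) n = (if n = - int k then 1 else 0)"
  shows "f = Pplus f + (\<Sum>k<p. hscale (fourier f (- int (Suc k))) (e (Suc k)))"
proof (rule hyperfunction_fourier_eqI)
  fix n
  have "(\<Sum>k<p. fourier f (- int (Suc k)) * (if n = - int (Suc k) then 1 else 0))
      = (if n < 0 then fourier f n else 0)"
  proof (cases "n < 0 \<and> n \<ge> - int p")
    case True
    define j where "j = nat (- n) - 1"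
    have j: "j < p" "n = - int (Suc j)" using True by (auto simp: j_def)
    have "(\<Sum>k<p. fourier f (- int (Suc k)) * (if n = - int (Suc k) then 1 else 0))
        = (\<Sum>k<p. if k = j then fourier f (- int (Suc k)) else 0)"
      by (rule sum.cong) (auto simp: j)
    also have "\<dots> = fourier f n" using j by simp
    finally show ?thesis using True by simp
  next
    case False
    have "(\<Sum>k<p. fourier f (- int (Suc k)) * (if n = - int (Suc k) then 1 else 0)) = 0"
      by (rule sum.neutral) (use False in auto)
    then show ?thesis using False assms(1)[of n] by auto
  qed
  then show "fourier f n = fourier (Pplus f +
      (\<Sum>k<p. hscale (fourier f (- int (Suc k))) (e (Suc k)))) n"
    by (simp add: fourier_add fourier_sum fourier_hscale fourier_Pplus assms(2) del: of_nat_Suc)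
qed

section \<open>Normed spaces of hyperfunctions\<close>

locale hf_normed_space =
  fixes F :: "hyperfunction set" and N :: "hyperfunction \<Rightarrow> real"
  assumes normed: "hf_normed F N"
begin

sublocale Metric_space F "hf_dist F N"
  by (rule Metric_space_hf_dist[OF normed])

lemma subspace_F: "hf.subspace F"
  using normed by (simp add: hf_normed_def)

lemma zero_in_F: "0 \<in> F"
  using subspace_F by (rule hf.subspace_0)

lemma add_in_F: "f \<in> F \<Longrightarrow> g \<in> F \<Longrightarrow> f + g \<in> F"
  using subspace_F by (rule hf.subspace_add)

lemma diff_in_F: "f \<in> F \<Longrightarrow> g \<in> F \<Longrightarrow> f - g \<in> F"
  using subspace_F by (rule hf.subspace_diff)

lemma scale_in_F: "f \<in> F \<Longrightarrow> hscale c f \<in> F"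
  using subspace_F by (rule hf.subspace_scale)

lemma sum_in_F: "(\<And>i. i \<in> I \<Longrightarrow> f i \<in> F) \<Longrightarrow> sum f I \<in> F"
  using subspace_F by (rule hf.subspace_sum)

lemma norm_nonneg: "f \<in> F \<Longrightarrow> 0 \<le> N f"
  and norm_zero_iff: "f \<in> F \<Longrightarrow> N f = 0 \<longleftrightarrow> f = 0"
  and norm_scale: "f \<in> F \<Longrightarrow> N (hscale c f) = norm c * N f"
  and norm_triangle: "f \<in> F \<Longrightarrow> g \<in> F \<Longrightarrow> N (f + g) \<le> N f + N g"
  using normed by (auto simp: hf_normed_def)

lemma norm_0: "N 0 = 0"
  using norm_zero_iff[OF zero_in_F] by simp

lemma norm_minus_commute: "f \<in> F \<Longrightarrow> g \<in> F \<Longrightarrow> N (f - g) = N (g - f)"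
  using norm_scale[of "f - g" "- 1"] diff_in_F by simp

lemma norm_triangle_diff: "f \<in> F \<Longrightarrow> g \<in> F \<Longrightarrow> N (f - g) \<le> N f + N g"
  using norm_triangle[of f "- g"] norm_scale[of g "- 1"] scale_in_F[of g "- 1"] by simp

lemma norm_sum: "(\<And>i. i \<in> I \<Longrightarrow> f i \<in> F) \<Longrightarrow> N (sum f I) \<le> (\<Sum>i\<in>I. N (f i))"
proof (induction I rule: infinite_finite_induct)
  case (insert x I)
  have "N (f x + sum f I) \<le> N (f x) + N (sum f I)"
    using insert.prems by (intro norm_triangle sum_in_F) auto
  with insert show ?case by fastforce
qed (auto simp: norm_0)

lemma closure_iff:
  assumes "A \<subseteq> F"
  shows "f \<in> hf_topology F N closure_of A \<longleftrightarrow> f \<in> F \<and> (\<forall>r>0. \<exists>a\<in>A. N (f - a) < r)"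
  using assms unfolding hf_topology_def metric_closure_of
  by (fastforce simp: hf_dist_def)

text \<open>An additive homogeneous operator that is continuous on \<open>F\<close> is bounded.\<close>

lemma continuous_linear_bounded:
  assumes "T ` F \<subseteq> F" and add: "\<And>f g. f \<in> F \<Longrightarrow> g \<in> F \<Longrightarrow> T (f + g) = T f + T g"
    and sc: "\<And>c f. f \<in> F \<Longrightarrow> T (hscale c f) = hscale c (T f)"
    and cont: "continuous_map (hf_topology F N) (hf_topology F N) T"
  obtains C where "C \<ge> 0" "\<And>f. f \<in> F \<Longrightarrow> N (T f) \<le> C * N f"
proof -
  have T0: "T 0 = 0" using sc[OF zero_in_F, of 0] by simp
  let ?U = "{x \<in> F. T x \<in> mball 0 1}"
  have "openin mtopology ?U"
    using openin_continuous_map_preimage[OF cont[unfolded hf_topology_def] openin_mball, of 0 1]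
    by (simp add: topspace_mtopology)
  moreover have "0 \<in> ?U" using zero_in_F T0 by simp
  ultimately obtain r where r: "r > 0" "mball 0 r \<subseteq> ?U"
    unfolding openin_mtopology by blast
  have small: "N (T f) \<le> 1" if "f \<in> F" "N f < r" for f
  proof -
    have "f \<in> mball 0 r"
      using that norm_minus_commute[OF zero_in_F that(1)] zero_in_F by (simp add: hf_dist_def)
    then have "T f \<in> mball 0 1" using r by blast
    then show ?thesis
      using norm_minus_commute[of 0 "T f"] zero_in_F by (simp add: hf_dist_def split: if_splits)
  qed
  show ?thesis
  proof (rule that[of "2 / r"])
    fix f
    assume f: "f \<in> F"
    show "N (T f) \<le> 2 / r * N f"
    proof (cases "f = 0")
      case True
      then show ?thesis by (simp add: T0 norm_0)
    next
      case False
      then have pos: "N f > 0" using norm_nonneg[OF f] norm_zero_iff[OF f] by linarith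
      define c where "c = r / (2 * N f)"
      have c: "c > 0" using r pos by (simp add: c_def)
      have "N (hscale (of_real c) f) = r / 2"
        using c pos by (simp add: norm_scale[OF f], simp add: c_def)
      then have "N (T (hscale (of_real c) f)) \<le> 1"
        using r by (intro small scale_in_F f) auto
      then have "c * N (T f) \<le> 1"
        using c f assms(1) by (subst (asm) sc[OF f], subst (asm) norm_scale) auto
      then show ?thesis using r pos by (simp add: c_def field_simps)
    qed
  qed (use r in auto)
qed

text \<open>The supremum that defines the dual norm is a real number only for a bounded functional, so
  its two basic properties need a bound \<open>C\<close> to begin with.\<close>

lemma dual_norm_bound:
  assumes C: "\<And>f. f \<in> F \<Longrightarrow> norm (L f) \<le> C * N f"
    and sc: "\<And>c f. f \<in> F \<Longrightarrow> L (hscale c f) = c * L f"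
  shows "0 \<le> dual_norm F N L" and "f \<in> F \<Longrightarrow> norm (L f) \<le> dual_norm F N L * N f"
proof -
  have bdd: "bdd_above ((\<lambda>f. norm (L f)) ` {f \<in> F. N f \<le> 1})"
  proof (rule bdd_aboveI2)
    fix f assume f: "f \<in> {f \<in> F. N f \<le> 1}"
    have "C * N f \<le> \<bar>C\<bar> * 1"
      using f norm_nonneg[of f] by (intro mult_mono) auto
    with C[of f] f show "norm (L f) \<le> \<bar>C\<bar>" by auto
  qed
  have le: "norm (L f) \<le> dual_norm F N L" if "f \<in> F" "N f \<le> 1" for f
    unfolding dual_norm_def by (rule cSUP_upper[OF _ bdd]) (use that in auto)
  show "0 \<le> dual_norm F N L"
    using order_trans[OF norm_ge_zero le[OF zero_in_F]] norm_0 by simp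
  show "norm (L f) \<le> dual_norm F N L * N f" if f: "f \<in> F"
  proof (cases "f = 0")
    case True
    then show ?thesis using C[OF f] by (simp add: norm_0)
  next
    case False
    then have pos: "N f > 0" using norm_nonneg[OF f] norm_zero_iff[OF f] by linarith
    define c where "c = inverse (N f)"
    have c: "c > 0" using pos by (simp add: c_def)
    have "N (hscale (of_real c) f) = 1"
      using c pos by (simp add: norm_scale[OF f], simp add: c_def)
    then have "norm (L (hscale (of_real c) f)) \<le> dual_norm F N L"
      by (intro le scale_in_F f) auto
    then have "c * norm (L f) \<le> dual_norm F N L"
      using c by (simp add: sc[OF f] norm_mult)
    then show ?thesis using pos by (simp add: c_def field_simps)
  qed
qed

end

section \<open>Banach spaces stable under the shift and the analytic projection\<close>

locale hf_class_space =
  fixes F :: "hyperfunction set" and N :: "hyperfunction \<Rightarrow> real"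
  assumes cls: "hf_class F N"
begin

sublocale hf_normed_space F N
  by unfold_locales (use cls in \<open>simp add: hf_class_def hf_banach_def\<close>)

text \<open>The inverse of the bilateral shift; its values matter on \<open>F\<close> only.\<close>

abbreviation "T \<equiv> bshift_inv F"

text \<open>The analytic part of \<open>F\<close>.\<close>

abbreviation "Fp \<equiv> F \<inter> holD"

lemma complete: "mcomplete"
  using cls by (simp add: hf_class_def hf_banach_def)

lemma Pplus_in_F: "f \<in> F \<Longrightarrow> Pplus f \<in> F"
  and bshift_in_F: "f \<in> F \<Longrightarrow> bshift f \<in> F"
  using cls by (auto simp: hf_class_def)

lemma Pplus_bounded:
  obtains C where "C \<ge> 0" "\<And>f. f \<in> F \<Longrightarrow> N (Pplus f) \<le> C * N f"
  by (rule continuous_linear_bounded[of Pplus])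
    (use cls in \<open>auto simp: hf_class_def Pplus_add Pplus_hscale\<close>)

lemma bshift_bounded:
  obtains C where "C \<ge> 0" "\<And>f. f \<in> F \<Longrightarrow> N (bshift f) \<le> C * N f"
  by (rule continuous_linear_bounded[of bshift])
    (use cls in \<open>auto simp: hf_class_def bshift_add bshift_hscale\<close>)

text \<open>The inverse of the bilateral shift is defined on all of \<open>F\<close> and bounded, because \<open>0\<close> is not
  in the spectrum.\<close>

lemma bounded_inverse_ex:
  obtains C where "C \<ge> 0" "\<And>f. f \<in> F \<Longrightarrow> T f \<in> F" "\<And>f. f \<in> F \<Longrightarrow> bshift (T f) = f"
    "\<And>f. f \<in> F \<Longrightarrow> N (T f) \<le> C * N f"
proof -
  \<comment> \<open>The resolvent at \<open>0\<close> is the inverse of \<open>- bshift\<close>.\<close>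
  have "0 \<notin> hf_spectrum F N bshift"
    using cls by (auto simp: hf_class_def)
  then obtain R where R: "hf_bounded_op F N R"
    "\<And>f. f \<in> F \<Longrightarrow> hscale 0 (R f) - bshift (R f) = f"
    unfolding hf_spectrum_def by blast
  have RF: "R f \<in> F" if "f \<in> F" for f using R(1) that by (auto simp: hf_bounded_op_def)
  obtain C where C: "C \<ge> 0" "\<And>f. f \<in> F \<Longrightarrow> N (R f) \<le> C * N f"
    by (rule continuous_linear_bounded[of R]) (use R(1) in \<open>auto simp: hf_bounded_op_def\<close>)
  have bR: "bshift (hscale (- 1) (R f)) = f" if "f \<in> F" for f
    using R(2)[OF that] unfolding bshift_hscale by simp
  have TR: "T f = hscale (- 1) (R f)" if "f \<in> F" for f
    unfolding bshift_inv_def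
    by (intro inv_into_f_eq scale_in_F RF bR that) (auto intro: inj_onI inj_bshift)
  show ?thesis
  proof (rule that[OF C(1)])
    fix f assume f: "f \<in> F"
    show "T f \<in> F" "bshift (T f) = f"
      using TR[OF f] scale_in_F[OF RF[OF f], of "- 1"] bR[OF f] by simp_all
    show "N (T f) \<le> C * N f"
      using C(2)[OF f] norm_scale[OF RF[OF f], of "- 1"] TR[OF f] by simp
  qed
qed

lemma T_in_F: "f \<in> F \<Longrightarrow> T f \<in> F"
  and bshift_T: "f \<in> F \<Longrightarrow> bshift (T f) = f"
  using bounded_inverse_ex[of "T f \<in> F \<and> bshift (T f) = f"] by blast+

lemma T_bounded: "\<exists>C\<ge>0. \<forall>f\<in>F. N (T f) \<le> C * N f"
  by (rule bounded_inverse_ex) blast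

lemma fourier_T: "f \<in> F \<Longrightarrow> fourier (T f) n = fourier f (n + 1)"
  using fourier_bshift[of "T f" "n + 1"] by (simp add: bshift_T)

lemma T_bshift: "f \<in> F \<Longrightarrow> T (bshift f) = f"
  by (rule inj_bshift) (simp add: bshift_T bshift_in_F)

lemma funpow_T_in_F: "f \<in> F \<Longrightarrow> (T ^^ k) f \<in> F"
  by (induction k) (auto intro: T_in_F)

lemma fourier_funpow_T: "f \<in> F \<Longrightarrow> fourier ((T ^^ k) f) n = fourier f (n + int k)"
  by (induction k arbitrary: n) (auto simp: fourier_T funpow_T_in_F algebra_simps)

lemma funpow_T_add:
  "f \<in> F \<Longrightarrow> g \<in> F \<Longrightarrow> (T ^^ k) (f + g) = (T ^^ k) f + (T ^^ k) g"
  by (rule hyperfunction_fourier_eqI) (simp add: fourier_funpow_T fourier_add add_in_F)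

lemma funpow_T_scale: "f \<in> F \<Longrightarrow> (T ^^ k) (hscale c f) = hscale c ((T ^^ k) f)"
  by (rule hyperfunction_fourier_eqI) (simp add: fourier_funpow_T fourier_hscale scale_in_F)

lemma subspace_funpow_T_image:
  assumes "hf.subspace W" "W \<subseteq> F"
  shows "hf.subspace ((T ^^ k) ` W)"
proof (rule hf.subspaceI)
  have "(T ^^ k) 0 = 0"
    by (rule hyperfunction_fourier_eqI) (simp add: fourier_funpow_T fourier_zero zero_in_F)
  then show "0 \<in> (T ^^ k) ` W"
    using hf.subspace_0[OF assms(1)] by (metis imageI)
next
  fix x y assume "x \<in> (T ^^ k) ` W" "y \<in> (T ^^ k) ` W"
  then obtain a b where "a \<in> W" "x = (T ^^ k) a" "b \<in> W" "y = (T ^^ k) b" by blast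
  then show "x + y \<in> (T ^^ k) ` W"
    using funpow_T_add[of a b k] hf.subspace_add[OF assms(1), of a b] assms(2)
    by (metis image_eqI subsetD)
next
  fix c x assume "x \<in> (T ^^ k) ` W"
  then obtain a where "a \<in> W" "x = (T ^^ k) a" by blast
  then show "hscale c x \<in> (T ^^ k) ` W"
    using funpow_T_scale[of a k c] hf.subspace_scale[OF assms(1), of a c] assms(2)
    by (metis image_eqI subsetD)
qed

lemma subspace_Fp: "hf.subspace Fp"
  by (intro hf.subspace_inter subspace_F subspace_holD)

text \<open>The constant Fourier coefficient is recovered inside \<open>F\<close> from the shift and \<open>P\<^sup>+\<close>; this
  gives both that \<open>F\<close> contains the constants and that the coefficient functionals are bounded.\<close>

lemma hscale_fourier_hone:
  assumes "f \<in> F"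
  shows "hscale (fourier f 0) hone = Pplus f - bshift (Pplus (T f))"
  by (rule hyperfunction_fourier_eqI)
    (use assms in \<open>auto simp: fourier_hscale fourier_hone fourier_diff fourier_Pplus
      fourier_bshift fourier_T\<close>)

lemma hone_in_Fp: "hone \<in> Fp"
proof -
  have "\<exists>f\<in>F. f \<noteq> 0"
    using cls zero_in_F by (auto simp: hf_class_def)
  then obtain f n where f: "f \<in> F" "fourier f n \<noteq> 0"
    by (metis hyperfunction_fourier_eqI fourier_zero)
  have "\<exists>g\<in>F. fourier g 0 \<noteq> 0"
  proof (cases "n \<ge> 0")
    case True
    then show ?thesis
      using f funpow_T_in_F[of f "nat n"] fourier_funpow_T[of f "nat n" 0] by force
  next
    case False
    have "(bshift ^^ k) f \<in> F \<and> (\<forall>j. fourier ((bshift ^^ k) f) j = fourier f (j - int k))" for k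
      by (induction k) (auto simp: f bshift_in_F fourier_bshift algebra_simps)
    from this[of "nat (- n)"] have "(bshift ^^ nat (- n)) f \<in> F"
      "fourier ((bshift ^^ nat (- n)) f) 0 = fourier f n"
      using False by simp_all
    then show ?thesis using f(2) by metis
  qed
  then obtain g where g: "g \<in> F" "fourier g 0 \<noteq> 0" by blast
  have "hscale (fourier g 0) hone \<in> F"
    unfolding hscale_fourier_hone[OF g(1)] using g(1)
    by (intro diff_in_F bshift_in_F Pplus_in_F T_in_F)
  from scale_in_F[OF this, of "inverse (fourier g 0)"] g(2)
  have "hone \<in> F" by simp
  then show ?thesis by (simp add: holD_iff fourier_hone)
qed

lemma fourier_0_bounded:
  obtains C where "C \<ge> 0" "\<And>f. f \<in> F \<Longrightarrow> norm (fourier f 0) \<le> C * N f"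
proof -
  obtain P where P: "P \<ge> 0" "\<And>f. f \<in> F \<Longrightarrow> N (Pplus f) \<le> P * N f"
    using Pplus_bounded by blast
  obtain B where B: "B \<ge> 0" "\<And>f. f \<in> F \<Longrightarrow> N (bshift f) \<le> B * N f"
    using bshift_bounded by blast
  obtain R where R: "R \<ge> 0" "\<And>f. f \<in> F \<Longrightarrow> N (T f) \<le> R * N f"
    using T_bounded by blast
  have "hone \<noteq> 0"
    using fourier_hone[of 0] fourier_zero[of 0] by auto
  then have pos: "N hone > 0"
    using norm_nonneg[of hone] norm_zero_iff[of hone] hone_in_Fp by force
  have "norm (fourier f 0) \<le> (P + B * (P * R)) / N hone * N f" if f: "f \<in> F" for f
  proof -
    note [simp] = f T_in_F Pplus_in_F bshift_in_F
    have "norm (fourier f 0) * N hone = N (hscale (fourier f 0) hone)"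
      using hone_in_Fp by (simp add: norm_scale)
    also have "\<dots> \<le> N (Pplus f) + N (bshift (Pplus (T f)))"
      unfolding hscale_fourier_hone[OF f] by (rule norm_triangle_diff) auto
    also have "N (bshift (Pplus (T f))) \<le> B * N (Pplus (T f))"
      by (rule B(2)) auto
    also have "B * N (Pplus (T f)) \<le> B * (P * N (T f))"
      by (rule mult_left_mono[OF P(2) B(1)]) auto
    also have "B * (P * N (T f)) \<le> B * (P * (R * N f))"
      by (intro mult_left_mono R P B f)
    also have "N (Pplus f) \<le> P * N f" by (rule P(2)) auto
    finally show ?thesis using pos by (simp add: field_simps)
  qed
  with P B R pos show ?thesis by (intro that[of "(P + B * (P * R)) / N hone"]) auto
qed

lemma fourier_neg_bounded: "\<exists>C. \<forall>f\<in>F. norm (fourier f (- int k)) \<le> C * N f"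
proof -
  obtain A where A: "A \<ge> 0" "\<And>f. f \<in> F \<Longrightarrow> norm (fourier f 0) \<le> A * N f"
    using fourier_0_bounded by blast
  obtain B where B: "B \<ge> 0" "\<And>f. f \<in> F \<Longrightarrow> N (bshift f) \<le> B * N f"
    using bshift_bounded by blast
  show ?thesis
  proof (induction k)
    case 0
    then show ?case using A by auto
  next
    case (Suc k)
    then obtain C where C: "\<And>f. f \<in> F \<Longrightarrow> norm (fourier f (- int k)) \<le> C * N f" by blast
    have "norm (fourier f (- int (Suc k))) \<le> (\<bar>C\<bar> * B) * N f" if f: "f \<in> F" for f
    proof -
      have "- int (Suc k) = - int k - 1" by simp
      then have "fourier f (- int (Suc k)) = fourier (bshift f) (- int k)"
        by (simp only: fourier_bshift)
      then have "norm (fourier f (- int (Suc k))) \<le> C * N (bshift f)"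
        using C[OF bshift_in_F[OF f]] by simp
      also have "\<dots> \<le> \<bar>C\<bar> * N (bshift f)"
        by (intro mult_right_mono norm_nonneg bshift_in_F f) auto
      also have "\<dots> \<le> \<bar>C\<bar> * (B * N f)"
        by (intro mult_left_mono B f) auto
      finally show ?thesis by (simp add: mult.assoc)
    qed
    then show ?case by blast
  qed
qed

lemma fourier_neg_dual_norm:
  shows "0 \<le> dual_norm F N (\<lambda>f. fourier f (- int k))"
    and "f \<in> F \<Longrightarrow> norm (fourier f (- int k)) \<le> dual_norm F N (\<lambda>f. fourier f (- int k)) * N f"
proof -
  obtain C where "\<And>f. f \<in> F \<Longrightarrow> norm (fourier f (- int k)) \<le> C * N f"
    using fourier_neg_bounded by blast
  note dual_norm_bound[of "\<lambda>f. fourier f (- int k)", OF this fourier_hscale]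
  then show "0 \<le> dual_norm F N (\<lambda>f. fourier f (- int k))"
    "f \<in> F \<Longrightarrow> norm (fourier f (- int k)) \<le> dual_norm F N (\<lambda>f. fourier f (- int k)) * N f"
    by auto
qed

lemma Pplus_Fp: "f \<in> Fp \<Longrightarrow> Pplus f = f"
  by (rule hyperfunction_fourier_eqI) (auto simp: fourier_Pplus holD_iff)

text \<open>The analytic part is closed in \<open>F\<close>, being the fixed space of the bounded projection
  \<open>P\<^sup>+\<close>.\<close>

lemma Fp_limit:
  assumes "g \<in> F" and "\<And>r. r > 0 \<Longrightarrow> \<exists>h\<in>Fp. N (g - h) < r"
  shows "g \<in> Fp"
proof -
  obtain P where P: "P \<ge> 0" "\<And>f. f \<in> F \<Longrightarrow> N (Pplus f) \<le> P * N f"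
    using Pplus_bounded by blast
  have PgF: "Pplus g \<in> F" by (intro Pplus_in_F assms)
  have "N (Pplus g - g) \<le> e" if "e > 0" for e
  proof -
    have "e / (P + 1) > 0" using that P by simp
    then obtain h where h: "h \<in> Fp" "N (g - h) < e / (P + 1)" using assms(2) by blast
    have eq: "Pplus g - g = Pplus (g - h) - (g - h)"
      using Pplus_add[of "g - h" h] Pplus_Fp[OF h(1)] by (simp add: algebra_simps)
    have d: "g - h \<in> F" using assms h by (auto intro: diff_in_F)
    have "N (Pplus g - g) \<le> N (Pplus (g - h)) + N (g - h)"
      unfolding eq by (intro norm_triangle_diff Pplus_in_F d)
    also have "\<dots> \<le> (P + 1) * N (g - h)" using P(2)[OF d] by (simp add: distrib_right)
    also have "\<dots> \<le> (P + 1) * (e / (P + 1))"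
      using h(2) P(1) by (intro mult_left_mono) auto
    also have "\<dots> = e" using P(1) by simp
    finally show ?thesis .
  qed
  then have "N (Pplus g - g) \<le> 0" by (rule field_le_epsilon[where y = 0, simplified])
  then have "Pplus g = g"
    using norm_nonneg[OF diff_in_F[OF PgF assms(1)]] norm_zero_iff[OF diff_in_F[OF PgF assms(1)]]
    by simp
  then show ?thesis using Pplus_in_holD[of g] assms(1) by simp
qed

end

section \<open>Subspaces with the division property\<close>

locale hf_division_subspace = hf_class_space +
  fixes M :: "hyperfunction set"
  assumes subspace_M: "hf.subspace M" and M_Fp: "M \<subseteq> F \<inter> holD" and M_nonzero: "M \<noteq> {0}"
    and division: "division_property M 0"
begin

text \<open>The smallest linear subspace that contains \<open>M\<close> and is stable under the inverse of the
  bilateral shift.\<close>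

abbreviation "N0 \<equiv> hf.span (\<Union>p. (T ^^ p) ` M)"

text \<open>Division by \<open>z\<close> inside \<open>M\<close>, in terms of the bilateral shift.\<close>

lemma division_bshift:
  assumes "f \<in> M" "fourier f 0 = 0"
  obtains g where "g \<in> M" "f = bshift g"
proof -
  obtain g where g: "g \<in> M" "\<And>z. z \<in> ball 0 1 - {0} \<Longrightarrow> hplus g z = hplus f z / z"
    using division assms by (auto simp: division_property_def hplus_at_0)
  have p: "hplus (ushift g) z = z * hplus g z" and m: "hminus (ushift g) z = 0" for z
    by (transfer, simp)+
  have "f = ushift g"
  proof (rule hyperfunction_eqI)
    fix z :: complex assume "z \<in> ball 0 1"
    then show "hplus f z = hplus (ushift g) z"
      using g(2)[of z] assms(2) p[of z] hplus_at_0[of f] by (cases "z = 0") auto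
  next
    fix z :: complex
    show "hminus f z = hminus (ushift g) z"
      using assms M_Fp by (auto simp: m holD_def)
  qed
  also have "\<dots> = bshift g" using g(1) M_Fp by (intro ushift_eq_bshift) auto
  finally show ?thesis using that g(1) by blast
qed

lemma M_F: "m \<in> M \<Longrightarrow> m \<in> F"
  using M_Fp by auto

lemma fourier_M_neg: "m \<in> M \<Longrightarrow> n < 0 \<Longrightarrow> fourier m n = 0"
  using M_Fp by (auto simp: holD_iff)

text \<open>Dividing a nonzero element of \<open>M\<close> by \<open>z\<close> as often as it vanishes at \<open>0\<close>.\<close>

lemma unit_in_M:
  obtains f0 where "f0 \<in> M" "fourier f0 0 = 1"
proof -
  have ind: "\<exists>g\<in>M. fourier g 0 \<noteq> 0" if "f \<in> M" "fourier f (int n) \<noteq> 0" for f n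
    using that
  proof (induction n arbitrary: f)
    case (Suc n)
    show ?case
    proof (cases "fourier f 0 = 0")
      case True
      then obtain g where "g \<in> M" "f = bshift g"
        using division_bshift Suc.prems by blast
      then show ?thesis using Suc.IH[of g] Suc.prems by (simp add: fourier_bshift)
    qed (use Suc in auto)
  qed auto
  obtain f where f: "f \<in> M" "f \<noteq> 0"
    using M_nonzero hf.subspace_0[OF subspace_M] by blast
  then obtain n where n: "fourier f n \<noteq> 0"
    by (metis hyperfunction_fourier_eqI fourier_zero)
  then have "n \<ge> 0" using fourier_M_neg[OF f(1), of n] by linarith
  then obtain g where g: "g \<in> M" "fourier g 0 \<noteq> 0"
    using ind[of f "nat n"] f n by auto
  show ?thesis
    by (rule that[of "hscale (inverse (fourier g 0)) g"])
      (use g hf.subspace_scale[OF subspace_M] in \<open>auto simp: fourier_hscale\<close>)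
qed

lemma N0_sub_F: "N0 \<subseteq> F"
  by (rule hf.span_minimal[OF _ subspace_F]) (auto intro: funpow_T_in_F M_F)

lemma M_sub_N0: "M \<subseteq> N0"
proof
  fix m assume "m \<in> M"
  then have "(T ^^ 0) m \<in> N0" by (intro hf.span_base) blast
  then show "m \<in> N0" by simp
qed

text \<open>The part of \<open>N0\<close> generated by the first powers of the inverse shift. Its elements have no
  Fourier coefficients below \<open>-p\<close>, since those of \<open>M\<close> are analytic.\<close>

abbreviation "stage p \<equiv> hf.span (\<Union>j\<le>p. (T ^^ j) ` M)"

lemma stage_mono: "p \<le> q \<Longrightarrow> stage p \<subseteq> stage q"
  by (intro hf.span_mono UN_mono) auto

lemma N0_stage:
  assumes "x \<in> N0"
  obtains p where "x \<in> stage p"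
proof -
  have "x \<in> (\<Union>p. stage p)"
    using assms
  proof (induction rule: hf.span_induct_alt)
    case base
    then show ?case by (auto intro: hf.span_zero)
  next
    case (step c x y)
    then obtain p j where p: "y \<in> stage p" and j: "x \<in> (T ^^ j) ` M" by blast
    have "y \<in> stage (max p j)" using p stage_mono[of p "max p j"] by auto
    moreover have "x \<in> stage (max p j)" using j by (intro hf.span_base) auto
    ultimately show ?case by (blast intro: hf.span_add hf.span_scale)
  qed
  then show ?thesis using that by blast
qed

lemma fourier_stage:
  assumes "x \<in> stage p" "n < - int p"
  shows "fourier x n = 0"
  using assms(1)
  by (induction rule: hf.span_induct_alt)
    (use assms(2) in \<open>auto simp: fourier_zero fourier_add fourier_hscale fourier_funpow_T M_F
      fourier_M_neg\<close>)

text \<open>The algebraic core: applying the inverse shift to \<open>M\<close> produces no new analytic functions.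
  In a sum of elements of \<open>T^j M\<close>, \<open>j \<le> p\<close>, that is analytic, the coefficient at \<open>-p\<close> comes from
  the term \<open>T^p m\<close> only, so \<open>m\<close> vanishes at \<open>0\<close>; dividing \<open>m\<close> by \<open>z\<close> moves the
  term to \<open>T^(p-1) M\<close>.\<close>

lemma stage_Int_holD: "x \<in> stage p \<Longrightarrow> x \<in> holD \<Longrightarrow> x \<in> M"
proof (induction p)
  case 0
  then show ?case using subspace_M by (simp flip: hf.span_eq_iff)
next
  case (Suc p)
  have "stage (Suc p) = {a + b | a b. a \<in> stage p \<and> b \<in> hf.span ((T ^^ Suc p) ` M)}"
    unfolding atMost_Suc UN_insert hf.span_Un[symmetric] by (simp only: Un_commute)
  also have "hf.span ((T ^^ Suc p) ` M) = (T ^^ Suc p) ` M"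
    unfolding hf.span_eq_iff by (intro subspace_funpow_T_image subspace_M) (auto intro: M_F)
  finally obtain a m where a: "a \<in> stage p" and m: "m \<in> M" and x: "x = a + (T ^^ Suc p) m"
    using Suc.prems(1) by blast
  have "fourier x (- int (Suc p)) = fourier m 0"
    using fourier_stage[OF a, of "- int (Suc p)"]
    by (simp add: x fourier_add fourier_funpow_T[OF M_F[OF m]] del: funpow.simps of_nat_Suc)
  moreover have "fourier x (- int (Suc p)) = 0"
    using Suc.prems(2) by (simp add: holD_iff)
  ultimately obtain m' where m': "m' \<in> M" "m = bshift m'"
    using division_bshift[OF m] by metis
  have "(T ^^ Suc p) m = (T ^^ p) m'"
    using m' by (simp add: funpow_swap1 T_bshift M_F)
  moreover have "(T ^^ p) m' \<in> stage p" using m' by (intro hf.span_base) auto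
  ultimately have "x \<in> stage p" using a hf.span_add by (simp add: x)
  then show ?case using Suc by blast
qed

lemma N0_Int_holD: "x \<in> N0 \<Longrightarrow> x \<in> holD \<Longrightarrow> x \<in> M"
  using N0_stage stage_Int_holD by metis

end

section \<open>The inverse of the shift on the quotient\<close>

text \<open>A map \<open>U0\<close> with \<open>U0 \<circ> \<pi> \<circ> S = \<pi>\<close>. Every coset contains an element of the form \<open>S f\<close>, so
  this relation determines \<open>U0\<close> on the quotient.\<close>

locale hf_quotient_shift = hf_division_subspace +
  fixes U0 :: "hyperfunction set \<Rightarrow> hyperfunction set"
  assumes U0: "\<And>f. f \<in> F \<inter> holD \<Longrightarrow> U0 (ushift f +o M) = f +o M"
begin

lemma mem_coset_iff: "u \<in> f +o M \<longleftrightarrow> u - f \<in> M"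
  by (auto simp: elt_set_plus_def algebra_simps intro: bexI[of _ "u - f"])

lemma coset_eqI: "f - g \<in> M \<Longrightarrow> f +o M = g +o M"
  using hf.subspace_add[OF subspace_M, of _ "f - g"] hf.subspace_diff[OF subspace_M, of _ "f - g"]
  by (fastforce simp: mem_coset_iff)

text \<open>Subtracting a multiple of an element of \<open>M\<close> with value \<open>1\<close> at \<open>0\<close> makes \<open>h\<close> divisible by
  \<open>z\<close>, which computes \<open>U0\<close> on the coset of \<open>h\<close>.\<close>

lemma U0_step:
  assumes "h \<in> Fp"
  obtains h1 where "h1 \<in> Fp" "U0 (h +o M) = h1 +o M" "T h - h1 \<in> T ` M"
proof -
  obtain f0 where f0: "f0 \<in> M" "fourier f0 0 = 1" using unit_in_M .
  define m where "m = hscale (fourier h 0) f0"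
  have m: "m \<in> M" unfolding m_def using f0(1) by (rule hf.subspace_scale[OF subspace_M])
  define h1 where "h1 = T (h - m)"
  have hm: "h - m \<in> Fp"
    using assms m M_Fp by (intro hf.subspace_diff[OF subspace_Fp]) auto
  have "fourier h1 n = 0" if "n < 0" for n
    using that hm
    by (cases "n = - 1") (auto simp: h1_def fourier_T fourier_diff m_def fourier_hscale f0 holD_iff)
  then have h1: "h1 \<in> Fp" using hm by (auto simp: h1_def T_in_F holD_iff)
  have "ushift h1 = h - m"
    using h1 hm by (simp add: ushift_eq_bshift h1_def bshift_T)
  moreover have "(h - m) +o M = h +o M"
    using m hf.subspace_neg[OF subspace_M] by (intro coset_eqI) auto
  ultimately have "U0 (h +o M) = h1 +o M" using U0[OF h1] by simp
  moreover have "T h - h1 = T m"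
    by (rule hyperfunction_fourier_eqI)
      (use assms hm m in \<open>auto simp: h1_def fourier_diff fourier_T M_F\<close>)
  ultimately show ?thesis using that h1 m by blast
qed

text \<open>Modulo \<open>N0\<close>, the operator \<open>U0\<close> is the inverse of the bilateral shift.\<close>

lemma U0_power:
  assumes "h \<in> Fp"
  shows "\<exists>g\<in>Fp. (U0 ^^ k) (h +o M) = g +o M \<and> (T ^^ k) h - g \<in> N0"
  using assms
proof (induction k arbitrary: h)
  case 0
  then show ?case by (auto intro!: bexI[of _ h] hf.span_zero)
next
  case (Suc k)
  obtain h1 where h1: "h1 \<in> Fp" "U0 (h +o M) = h1 +o M" "T h - h1 \<in> T ` M"
    using U0_step[OF Suc.prems] .
  then obtain m where m: "m \<in> M" "T h = T m + h1" by (metis diff_add_cancel imageE)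
  obtain g where g: "g \<in> Fp" "(U0 ^^ k) (h1 +o M) = g +o M" "(T ^^ k) h1 - g \<in> N0"
    using Suc.IH[OF h1(1)] by blast
  have "(T ^^ Suc k) h = (T ^^ Suc k) m + (T ^^ k) h1"
    using h1 m by (simp add: funpow_swap1 funpow_T_add T_in_F M_F)
  moreover have "(T ^^ Suc k) m \<in> N0" using m by (intro hf.span_base) blast
  ultimately have "(T ^^ Suc k) h - g \<in> N0"
    using hf.span_add[OF _ g(3)] by (simp add: add_diff_eq[symmetric] del: funpow.simps)
  moreover have "(U0 ^^ Suc k) (h +o M) = g +o M"
    using g(2) h1(2) by (simp add: funpow_swap1)
  ultimately show ?case using g(1) by blast
qed

lemma coset_sub_F: "h \<in> F \<Longrightarrow> h +o M \<subseteq> F"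
  by (auto simp: elt_set_plus_def intro: add_in_F M_F)

text \<open>Nearly minimal representatives of \<open>U0^k \<pi>(1)\<close>.\<close>

lemma U0_power_hone_rep:
  assumes "\<epsilon> > 0"
  obtains u where "u \<in> Fp" "(T ^^ k) hone - u \<in> N0"
    "N u \<le> quot_norm N ((U0 ^^ k) (hone +o M)) + \<epsilon>"
proof -
  obtain g where g: "g \<in> Fp" "(U0 ^^ k) (hone +o M) = g +o M" "(T ^^ k) hone - g \<in> N0"
    using U0_power[OF hone_in_Fp] by blast
  have ne: "g +o M \<noteq> {}"
    using hf.subspace_0[OF subspace_M] by (auto simp: elt_set_plus_def)
  have "(INF f\<in>g +o M. N f) < quot_norm N (g +o M) + \<epsilon>"
    using assms by (simp add: quot_norm_def)
  then obtain u where u: "u \<in> g +o M" "N u < quot_norm N (g +o M) + \<epsilon>"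
    using cInf_lessD[of "N ` (g +o M)"] ne by auto
  have ug: "u - g \<in> M" using u by (simp add: mem_coset_iff)
  then have "u \<in> Fp"
    using hf.subspace_add[OF subspace_Fp, of g "u - g"] g(1) M_Fp by auto
  moreover have "(T ^^ k) hone - u \<in> N0"
    using hf.span_diff[OF g(3) subsetD[OF M_sub_N0 ug]] by simp
  ultimately show ?thesis using that u(2) g(2) by auto
qed

lemma quot_norm_U0_nonneg: "0 \<le> quot_norm N ((U0 ^^ k) (hone +o M))"
proof -
  obtain g where g: "g \<in> Fp" "(U0 ^^ k) (hone +o M) = g +o M"
    using U0_power[OF hone_in_Fp] by blast
  have "0 \<le> (INF f\<in>g +o M. N f)"
    using coset_sub_F[of g] g(1) hf.subspace_0[OF subspace_M]
    by (intro cINF_greatest norm_nonneg) (auto simp: elt_set_plus_def)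
  then show ?thesis by (simp add: g(2) quot_norm_def)
qed

text \<open>The key estimate: the distance of \<open>h\<close> to \<open>M\<close> is at most \<open>C\<close> times the norm of \<open>n + h\<close>. Only
  finitely many negative Fourier coefficients of \<open>n + h\<close> are nonzero, but the constant has to
  be independent of their number; this is where the summability enters.\<close>

lemma distance_estimate:
  assumes summ: "summable (\<lambda>p. dual_norm F N (\<lambda>f. fourier f (- int (Suc p))) *
      quot_norm N ((U0 ^^ Suc p) (hone +o M)))"
  obtains C where "C \<ge> 0"
    "\<And>n h. n \<in> N0 \<Longrightarrow> h \<in> Fp \<Longrightarrow> \<exists>k\<in>M. N (h - k) \<le> C * N (n + h)"
proof -
  define D where "D p = dual_norm F N (\<lambda>f. fourier f (- int (Suc p)))" for p
  define q where "q p = quot_norm N ((U0 ^^ Suc p) (hone +o M))" for p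
  have D0: "D p \<ge> 0" for p unfolding D_def by (rule fourier_neg_dual_norm(1))
  have D: "norm (fourier f (- int (Suc p))) \<le> D p * N f" if "f \<in> F" for f p
    unfolding D_def using that by (rule fourier_neg_dual_norm(2))
  \<comment> \<open>The tolerance is chosen so small that it contributes at most \<open>(1/2)^p\<close> to the sum.\<close>
  define \<epsilon> where "\<epsilon> p = (1 / 2) ^ p / (1 + D p)" for p
  have "\<epsilon> p > 0" for p using D0[of p] by (simp add: \<epsilon>_def)
  then have "\<exists>u. u \<in> Fp \<and> (T ^^ Suc p) hone - u \<in> N0 \<and> N u \<le> q p + \<epsilon> p" for p
    unfolding q_def using U0_power_hone_rep by metis
  then obtain u where u: "\<And>p. u p \<in> Fp" "\<And>p. (T ^^ Suc p) hone - u p \<in> N0"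
      "\<And>p. N (u p) \<le> q p + \<epsilon> p"
    by metis
  have De: "D p * \<epsilon> p \<le> (1 / 2) ^ p" for p
  proof -
    have "D p / (1 + D p) * (1 / 2) ^ p \<le> 1 * (1 / 2) ^ p"
      using D0[of p] by (intro mult_right_mono) auto
    then show ?thesis by (simp add: \<epsilon>_def)
  qed
  have summ': "summable (\<lambda>p. D p * q p + (1 / 2) ^ p)"
    using summ by (intro summable_add) (auto simp: D_def q_def)
  define K where "K = (\<Sum>p. D p * q p + (1 / 2) ^ p)"
  have q0: "q p \<ge> 0" for p unfolding q_def by (rule quot_norm_U0_nonneg)
  have K: "(\<Sum>p<m. D p * N (u p)) \<le> K" for m
  proof -
    have "D p * N (u p) \<le> D p * q p + (1 / 2) ^ p" for p
      using mult_left_mono[OF u(3) D0[of p], of p] De[of p] by (simp add: distrib_left)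
    then have "(\<Sum>p<m. D p * N (u p)) \<le> (\<Sum>p<m. D p * q p + (1 / 2) ^ p)"
      by (intro sum_mono)
    also have "\<dots> \<le> K"
      unfolding K_def by (rule sum_le_suminf[OF summ']) (auto simp: D0 q0)
    finally show ?thesis .
  qed
  have K0: "K \<ge> 0" using K[of 0] by simp
  obtain P where P: "P \<ge> 0" "\<And>f. f \<in> F \<Longrightarrow> N (Pplus f) \<le> P * N f"
    using Pplus_bounded by blast
  show ?thesis
  proof (rule that[of "P + K"])
    fix n h
    assume n: "n \<in> N0" and h: "h \<in> Fp"
    define f where "f = n + h"
    have f: "f \<in> F" unfolding f_def using n h N0_sub_F by (intro add_in_F) auto
    obtain p where p: "n \<in> stage p" using N0_stage[OF n] .
    have "fourier f j = 0" if "j < - int p" for j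
      using fourier_stage[OF p that] h that by (simp add: f_def fourier_add holD_iff)
    then have decomp: "f = Pplus f + (\<Sum>k<p. hscale (fourier f (- int (Suc k))) ((T ^^ Suc k) hone))"
      by (rule eq_Pplus_add_sum) (use hone_in_Fp in \<open>auto simp: fourier_funpow_T fourier_hone\<close>)
    define w where "w = Pplus f + (\<Sum>k<p. hscale (fourier f (- int (Suc k))) (u k))"
    have w: "w \<in> Fp" unfolding w_def
      by (intro hf.subspace_add[OF subspace_Fp] hf.subspace_sum[OF subspace_Fp]
          hf.subspace_scale[OF subspace_Fp] u) (use f in \<open>auto simp: Pplus_in_F Pplus_in_holD\<close>)
    have "f - w = (\<Sum>k<p. hscale (fourier f (- int (Suc k))) ((T ^^ Suc k) hone - u k))"
      by (subst decomp)
        (simp add: w_def hf.scale_right_diff_distrib sum_subtractf del: of_nat_Suc funpow.simps)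
    also have "\<dots> \<in> N0" by (intro hf.span_sum hf.span_scale u)
    finally have "f - w - n \<in> N0" using n by (rule hf.span_diff)
    then have "h - w \<in> N0" by (simp add: f_def)
    moreover have "h - w \<in> Fp" using h w by (rule hf.subspace_diff[OF subspace_Fp])
    ultimately have hw: "h - w \<in> M" using N0_Int_holD by blast
    have "N w \<le> N (Pplus f) + N (\<Sum>k<p. hscale (fourier f (- int (Suc k))) (u k))"
      unfolding w_def using u f by (intro norm_triangle Pplus_in_F sum_in_F scale_in_F) auto
    also have "N (\<Sum>k<p. hscale (fourier f (- int (Suc k))) (u k))
        \<le> (\<Sum>k<p. N (hscale (fourier f (- int (Suc k))) (u k)))"
      using u by (intro norm_sum scale_in_F) auto
    also have "\<dots> \<le> (\<Sum>k<p. (D k * N (u k)) * N f)"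
    proof (rule sum_mono)
      fix k
      have uk: "u k \<in> F" using u(1)[of k] by simp
      have "N (hscale (fourier f (- int (Suc k))) (u k)) = norm (fourier f (- int (Suc k))) * N (u k)"
        using uk by (rule norm_scale)
      also have "\<dots> \<le> (D k * N f) * N (u k)"
        by (intro mult_right_mono D f norm_nonneg uk)
      finally show "N (hscale (fourier f (- int (Suc k))) (u k)) \<le> (D k * N (u k)) * N f"
        by (simp add: mult_ac)
    qed
    also have "\<dots> = (\<Sum>k<p. D k * N (u k)) * N f"
      by (simp add: sum_distrib_right)
    also have "\<dots> \<le> K * N f" by (intro mult_right_mono K norm_nonneg f)
    also have "N (Pplus f) \<le> P * N f" by (rule P(2)[OF f])
    finally have "N (h - (h - w)) \<le> (P + K) * N (n + h)"
      by (simp add: distrib_right f_def)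
    with hw show "\<exists>k\<in>M. N (h - k) \<le> (P + K) * N (n + h)" by blast
  qed (use P K0 in auto)
qed

lemma span_funpow_T_Fp: "x \<in> hf.span (\<Union>p. (T ^^ p) ` Fp) \<longleftrightarrow> (\<exists>n\<in>N0. \<exists>h\<in>Fp. x = n + h)"
proof
  assume "x \<in> hf.span (\<Union>p. (T ^^ p) ` Fp)"
  then show "\<exists>n\<in>N0. \<exists>h\<in>Fp. x = n + h"
  proof (induction rule: hf.span_induct_alt)
    case base
    have "0 = 0 + (0 :: hyperfunction)" by simp
    then show ?case using hf.span_zero hf.subspace_0[OF subspace_Fp] by blast
  next
    case (step c x y)
    then obtain p h where h: "h \<in> Fp" "x = (T ^^ p) h" by blast
    obtain g where g: "g \<in> Fp" "(T ^^ p) h - g \<in> N0" using U0_power[OF h(1)] by blast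
    obtain n k where nk: "n \<in> N0" "k \<in> Fp" "y = n + k" using step by blast
    have "hscale c (x - g) + n \<in> N0" using g h nk by (intro hf.span_add hf.span_scale) auto
    moreover have "hscale c g + k \<in> Fp"
      using g nk by (intro hf.subspace_add[OF subspace_Fp] hf.subspace_scale[OF subspace_Fp])
    moreover have "hscale c x + y = (hscale c (x - g) + n) + (hscale c g + k)"
      by (simp add: nk hf.scale_right_diff_distrib)
    ultimately show ?case by blast
  qed
next
  assume "\<exists>n\<in>N0. \<exists>h\<in>Fp. x = n + h"
  then obtain n h where nh: "n \<in> N0" "h \<in> Fp" "x = n + h" by blast
  have "n \<in> hf.span (\<Union>p. (T ^^ p) ` Fp)"
    using nh(1) hf.span_mono[of "\<Union>p. (T ^^ p) ` M" "\<Union>p. (T ^^ p) ` Fp"] M_Fp by blast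
  moreover have "(T ^^ 0) h \<in> hf.span (\<Union>p. (T ^^ p) ` Fp)"
    using nh(2) by (intro hf.span_base) blast
  ultimately show "x \<in> hf.span (\<Union>p. (T ^^ p) ` Fp)" using nh hf.span_add by simp
qed

end

section \<open>Closed spans of the backward orbits\<close>

theorem theorem6p2:
  fixes F M Fp :: "hyperfunction set"
    and N :: "hyperfunction \<Rightarrow> real"
    and L :: "int \<Rightarrow> hyperfunction \<Rightarrow> complex"
    and \<pi> :: "hyperfunction \<Rightarrow> hyperfunction set"
    and U0 :: "hyperfunction set \<Rightarrow> hyperfunction set"
  defines "Fp \<equiv> F \<inter> holD"
    and "L \<equiv> (\<lambda>n f. fourier f n)"
    and "\<pi> \<equiv> (\<lambda>f. f +o M)"
  assumes "hf_class F N"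
    and "hf.subspace M" and "M \<subseteq> Fp" and "M \<noteq> {0}"
    and "closedin (subtopology (hf_topology F N) Fp) M"
    and "division_property M 0"
    and "quot_linear Fp M U0"
    and "\<forall>f\<in>Fp. U0 (\<pi> (ushift f)) = \<pi> f"
    and "summable (\<lambda>p. dual_norm F N (L (- int (Suc p))) * quot_norm N ((U0 ^^ Suc p) (\<pi> hone)))"
  shows "(hf_topology F N closure_of hf.span (\<Union>p. (bshift_inv F ^^ p) ` M)) \<inter> Fp = M \<and>
    hf_topology F N closure_of hf.span (\<Union>p. (bshift_inv F ^^ p) ` Fp) =
    (hf_topology F N closure_of hf.span (\<Union>p. (bshift_inv F ^^ p) ` M)) + Fp"
proof -
  interpret hf_quotient_shift F N M U0
    by unfold_locales (use assms in \<open>auto simp: Fp_def \<pi>_def\<close>)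
  note [simp] = add_in_F diff_in_F
  let ?B = "hf.span (\<Union>p. (bshift_inv F ^^ p) ` Fp)"
  let ?cl = "\<lambda>A. hf_topology F N closure_of A"
  have B: "x \<in> ?B \<longleftrightarrow> (\<exists>n\<in>N0. \<exists>h\<in>Fp. x = n + h)" for x
    unfolding Fp_def by (rule span_funpow_T_Fp)
  have FpF: "h \<in> F" if "h \<in> Fp" for h using that by (simp add: Fp_def)
  have N0F: "n \<in> F" if "n \<in> N0" for n using that N0_sub_F by blast
  have sFp: "hf.subspace Fp" unfolding Fp_def by (rule subspace_Fp)
  have BF: "?B \<subseteq> F" using B FpF N0F by auto
  obtain C where C: "C \<ge> 0"
    and est: "\<And>n h. n \<in> N0 \<Longrightarrow> h \<in> Fp \<Longrightarrow> \<exists>k\<in>M. N (h - k) \<le> C * N (n + h)"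
    using distance_estimate assms(12) unfolding L_def \<pi>_def Fp_def by metis
  have Mcl: "Fp \<inter> ?cl M = M"
    using assms(8) by (simp add: closedin_Int_closure_of)
  have part1: "?cl N0 \<inter> Fp = M"
  proof (rule antisym)
    have "M \<subseteq> ?cl N0"
      unfolding subset_iff closure_iff[OF N0_sub_F]
      using M_sub_N0 M_F by (auto intro!: bexI simp: norm_0)
    then show "M \<subseteq> ?cl N0 \<inter> Fp" using assms(6) by blast
    show "?cl N0 \<inter> Fp \<subseteq> M"
    proof
      fix x assume x: "x \<in> ?cl N0 \<inter> Fp"
      have xF: "x \<in> F" using x FpF by blast
      have "\<exists>k\<in>M. N (x - k) < r" if r: "r > 0" for r
      proof -
        have "r / (C + 1) > 0" using r C by simp
        then obtain n where n: "n \<in> N0" "N (x - n) < r / (C + 1)"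
          using x by (auto simp: closure_iff[OF N0_sub_F])
        have "- n \<in> N0" using n(1) by (rule hf.span_neg)
        then obtain k where k: "k \<in> M" "N (x - k) \<le> C * N (- n + x)"
          using est[of "- n" x] x by blast
        have "C * N (x - n) \<le> (C + 1) * N (x - n)"
          using norm_nonneg[of "x - n"] xF N0F n by (simp add: distrib_right)
        also have "\<dots> < (C + 1) * (r / (C + 1))"
          using n(2) C by (intro mult_strict_left_mono) auto
        finally have "N (x - k) < r" using k(2) C by simp
        with k(1) show ?thesis by blast
      qed
      then have "x \<in> ?cl M" using xF by (subst closure_iff) (auto intro: M_F)
      then show "x \<in> M" using Mcl x by blast
    qed
  qed
  have sup: "?cl N0 + Fp \<subseteq> ?cl ?B"
  proof
    fix x assume "x \<in> ?cl N0 + Fp"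
    then obtain a h where a: "a \<in> ?cl N0" and h: "h \<in> Fp" and x: "x = a + h"
      by (auto simp: set_plus_def)
    have aF: "a \<in> F" using a by (simp add: closure_iff[OF N0_sub_F])
    have "\<exists>b\<in>?B. N (x - b) < r" if "r > 0" for r
    proof -
      obtain n where n: "n \<in> N0" "N (a - n) < r"
        using a \<open>r > 0\<close> by (auto simp: closure_iff[OF N0_sub_F])
      have "n + h \<in> ?B" using n h B by blast
      moreover have "x - (n + h) = a - n" by (simp add: x)
      ultimately show ?thesis using n(2) by metis
    qed
    then show "x \<in> ?cl ?B" using aF h FpF by (simp add: closure_iff[OF BF] x)
  qed
  have sub: "?cl ?B \<subseteq> ?cl N0 + Fp"
  proof
    fix f assume f: "f \<in> ?cl ?B"
    have fF: "f \<in> F" using f by (simp add: closure_iff[OF BF])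
    have approx: "\<exists>n\<in>N0. \<exists>h\<in>Fp. N (f - (n + h)) < r" if "r > 0" for r
      using f that B by (fastforce simp: closure_iff[OF BF])
    define K where "K = 2 * C + 1"
    \<comment> \<open>Approximants \<open>n + h\<close> of \<open>f\<close> whose analytic summands form a Cauchy sequence: at each step
      the new \<open>h\<close> is corrected by an element of \<open>M\<close>, which is moved to the other summand.\<close>
    have "\<exists>s. \<forall>i. (fst (s i) \<in> N0 \<and> snd (s i) \<in> Fp \<and> N (f - (fst (s i) + snd (s i))) < (1/2) ^ i)
        \<and> N (snd (s (Suc i)) - snd (s i)) \<le> K * (1/2) ^ i"
    proof (rule dependent_nat_choice, goal_cases)
      case 1
      then show ?case using approx[of 1] by force
    next
      case (2 s i)
      define n where "n = fst s"
      define h where "h = snd s"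
      have nh: "n \<in> N0" "h \<in> Fp" "N (f - (n + h)) < (1/2) ^ i" using 2 by (auto simp: n_def h_def)
      obtain n1 h1 where nh1: "n1 \<in> N0" "h1 \<in> Fp" "N (f - (n1 + h1)) < (1/2) ^ Suc i"
        using approx[of "(1/2) ^ Suc i"] by auto
      have mem: "n \<in> F" "h \<in> F" "n1 \<in> F" "h1 \<in> F" using nh nh1 N0F FpF by auto
      have "n1 - n \<in> N0" "h1 - h \<in> Fp"
        using nh nh1 by (auto intro: hf.span_diff hf.subspace_diff[OF sFp])
      then obtain k where k: "k \<in> M" "N (h1 - h - k) \<le> C * N ((n1 - n) + (h1 - h))"
        using est by blast
      have "N ((n1 - n) + (h1 - h)) = N ((f - (n + h)) - (f - (n1 + h1)))"
        by (simp add: algebra_simps)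
      also have "\<dots> \<le> N (f - (n + h)) + N (f - (n1 + h1))"
        using mem fF by (intro norm_triangle_diff) auto
      also have "\<dots> \<le> 2 * (1/2) ^ i"
      proof -
        have "(1/2 :: real) ^ Suc i \<le> (1/2) ^ i" by simp
        then show ?thesis using nh(3) nh1(3) by linarith
      qed
      finally have "C * N ((n1 - n) + (h1 - h)) \<le> C * (2 * (1/2) ^ i)"
        using C by (rule mult_left_mono)
      also have "\<dots> \<le> K * (1/2) ^ i" by (simp add: K_def distrib_right)
      finally have "N (h1 - k - h) \<le> K * (1/2) ^ i" using k(2) by (simp add: algebra_simps)
      moreover have "n1 + k \<in> N0" using nh1(1) k(1) M_sub_N0 by (auto intro: hf.span_add)
      moreover have "h1 - k \<in> Fp"
        using nh1(2) k(1) assms(6) by (intro hf.subspace_diff[OF sFp]) auto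
      moreover have "f - ((n1 + k) + (h1 - k)) = f - (n1 + h1)" by simp
      ultimately show ?case
        using nh1(3) by (intro exI[of _ "(n1 + k, h1 - k)"]) (simp add: h_def)
    qed
    then obtain s where s: "\<And>i. fst (s i) \<in> N0" "\<And>i. snd (s i) \<in> Fp"
      "\<And>i. N (f - (fst (s i) + snd (s i))) < (1/2) ^ i"
      "\<And>i. N (snd (s (Suc i)) - snd (s i)) \<le> K * (1/2) ^ i"
      by metis
    define n where "n i = fst (s i)" for i
    define h where "h i = snd (s i)" for i
    have nh: "n i \<in> N0" "h i \<in> Fp" "N (f - (n i + h i)) < (1/2) ^ i"
      "N (h (Suc i) - h i) \<le> K * (1/2) ^ i" for i
      using s[of i] by (auto simp: n_def h_def)
    have mem: "n i \<in> F" "h i \<in> F" for i using nh N0F FpF by auto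
    have K0: "K > 0" using C by (simp add: K_def)
    have tail: "N (h (i + j) - h i) \<le> 2 * K * (1/2) ^ i - 2 * K * (1/2) ^ (i + j)" for i j
    proof (induction j)
      case 0
      then show ?case by (simp add: norm_0)
    next
      case (Suc j)
      have "N (h (i + Suc j) - h i) = N ((h (Suc (i + j)) - h (i + j)) + (h (i + j) - h i))" by simp
      also have "\<dots> \<le> N (h (Suc (i + j)) - h (i + j)) + N (h (i + j) - h i)"
        using mem by (intro norm_triangle) auto
      also have "\<dots> \<le> K * (1/2) ^ (i + j) + (2 * K * (1/2) ^ i - 2 * K * (1/2) ^ (i + j))"
        by (intro add_mono nh Suc.IH)
      finally show ?case by simp
    qed
    have tail': "N (h (i + j) - h i) \<le> 2 * K * (1/2) ^ i" for i j
      using tail[of i j] K0 by (smt (verit) zero_le_power mult_nonneg_nonneg zero_le_divide_1_iff)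
    have small: "\<exists>i0. \<forall>i\<ge>i0. A * (1/2) ^ i < r" if "r > 0" for A r :: real
    proof -
      have "(\<lambda>i. A * (1/2 :: real) ^ i) \<longlonglongrightarrow> A * 0"
        by (intro tendsto_mult tendsto_const LIMSEQ_power_zero) auto
      then show ?thesis using order_tendstoD(2)[of _ 0 sequentially r] that
        by (simp add: eventually_sequentially)
    qed
    have "MCauchy h"
      unfolding MCauchy_def
    proof (intro conjI allI impI)
      show "range h \<subseteq> F" using mem by auto
      fix r :: real assume "r > 0"
      then obtain i0 where i0: "\<forall>i\<ge>i0. (4 * K) * (1/2) ^ i < r" using small by blast
      have "hf_dist F N (h i) (h j) < r" if "i \<ge> i0" "j \<ge> i0" for i j
      proof -
        have "N (h i - h i0) \<le> 2 * K * (1/2) ^ i0" "N (h j - h i0) \<le> 2 * K * (1/2) ^ i0"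
          using tail'[of i0 "i - i0"] tail'[of i0 "j - i0"] that by auto
        moreover have "N (h i - h j) \<le> N (h i - h i0) + N (h j - h i0)"
          using norm_triangle_diff[of "h i - h i0" "h j - h i0"] mem by simp
        ultimately have "N (h i - h j) < r" using i0 by fastforce
        then show ?thesis using mem by (simp add: hf_dist_def)
      qed
      then show "\<exists>M. \<forall>n n'. M \<le> n \<longrightarrow> M \<le> n' \<longrightarrow> hf_dist F N (h n) (h n') < r" by blast
    qed
    then obtain g where g: "limitin mtopology h g sequentially"
      using complete by (auto simp: mcomplete_def)
    then have gF: "g \<in> F" using limitin_mspace by blast
    have glim: "\<exists>i0. \<forall>i\<ge>i0. N (g - h i) < r" if "r > 0" for r
      using g that gF mem norm_minus_commute[OF gF]
      by (auto simp: limitin_metric eventually_sequentially hf_dist_def)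
    have gFp: "g \<in> Fp" unfolding Fp_def
    proof (rule Fp_limit[OF gF])
      fix r :: real assume "r > 0"
      then obtain i where "N (g - h i) < r" using glim by blast
      then show "\<exists>h\<in>F \<inter> holD. N (g - h) < r" using nh(2)[of i] by (auto simp: Fp_def)
    qed
    have "\<exists>a\<in>N0. N ((f - g) - a) < r" if "r > 0" for r
    proof -
      obtain i0 where i0: "\<forall>i\<ge>i0. N (g - h i) < r / 2" using glim[of "r / 2"] \<open>r > 0\<close> by auto
      obtain i1 where i1: "\<forall>i\<ge>i1. 1 * (1/2) ^ i < r / 2" using small[of "r / 2" 1] \<open>r > 0\<close> by auto
      define i where "i = max i0 i1"
      have "N ((f - g) - n i) = N ((f - (n i + h i)) - (g - h i))" by (simp add: algebra_simps)
      also have "\<dots> \<le> N (f - (n i + h i)) + N (g - h i)"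
        using mem gF fF by (intro norm_triangle_diff) auto
      also have "\<dots> < r"
      proof -
        have "N (f - (n i + h i)) < r / 2"
          using nh(3)[of i] i1[rule_format, of i] by (simp add: i_def)
        moreover have "N (g - h i) < r / 2" using i0 by (simp add: i_def)
        ultimately show ?thesis by simp
      qed
      finally show ?thesis using nh(1) by blast
    qed
    then have "f - g \<in> ?cl N0" using fF gF by (simp add: closure_iff[OF N0_sub_F])
    from set_plus_intro[OF this gFp] show "f \<in> ?cl N0 + Fp" by simp
  qed
  show ?thesis using part1 sup sub by blast
qed

end
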